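(* Let $\mathfrak S$ be the group of all permutations of $\Omega=\{1,2,\dots\}$. There is a ring isomorphism $i\colon\mathbb Z\langle x\rangle\to\Theta(\mathfrak S)$ given by $i\left(\binom{x}{n}\right)=[\Omega^{(n)}]$ for all $n\ge 0$.
   Context: $\mathbb Z\langle x\rangle$ is the ring of integer-valued polynomials: those $p\in\mathbb Q[x]$ with $p(m)\in\mathbb Z$ for all $m\in\mathbb Z$; the polynomials $\binom{x}{n}$, $n\ge0$, form a $\mathbb Z$-basis. $\Omega^{(n)}$ is the set of $n$-element subsets of $\Omega$. The group $G=\mathfrak S$ carries the topology in which the pointwise stabilizers of finite subsets of $\Omega$ form a neighborhood basis of the identity. A $G$-set is a set with a smooth action of $G$, i.e. every stabilizer is open (same for open subgroups). A set with a group action is finitary if it has finitely many orbits. A $\hat G$-set is a set $X$ with a smooth action of some open subgroup $U$ of $G$ (a group of definition), where shrinking $U$ does not change the $\hat G$-set; it is finitary if $U$ has finitely many orbits (independent of $U$). Maps of $\hat G$-sets are functions equivariant for some common open group of definition. For $g\in G$, $X^g$ is the same set with action $h\bullet x=(g^{-1}hg)\cdot x$. $\Theta(G)$ is the commutative ring generated by symbols $[X]$, one for each finitary $\hat G$-set $X$, subject to: (a) $[X]=[Y]$ if $X\cong Y$; (b) $[X]=1$ if $X$ is a singleton; (c) $[X\amalg Y]=[X]+[Y]$; (d) $[X]=[X^g]$ for $g\in G$; (e) if $U$ is an open subgroup and $X\to Y$ is a map of transitive $U$-sets with fiber $F$ over some point, then $[X]=[F]\cdot[Y]$. *)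

theory Defs
  imports
    "HOL-Algebra.Group_Action"
    "HOL-Algebra.QuotRing"
    "HOL-Algebra.Algebraic_Closure_Type"
    "HOL-Computational_Algebra.Polynomial"
    "HOL-Library.Multiset"
    "HOL-Library.Poly_Mapping"
    "HOL-Library.Ramsey"
    "HOL-Library.Countable_Set"
    "HOL-Analysis.Abstract_Topology"
begin

(* otherwise the letter X denotes the indeterminate of HOL-Algebra polynomials *)
no_notation var (\<open>X\<index>\<close>)

section \<open>The symmetric group and its topology\<close>

type_synonym perm = "nat \<Rightarrow> nat"

definition Omega :: "nat set" where
  "Omega = {1..}"

definition Sym :: "perm monoid" where
  "Sym = BijGroup Omega"

definition pointwise_stab :: "nat set \<Rightarrow> perm set" where
  "pointwise_stab A = {g \<in> carrier Sym. \<forall>a\<in>A. g a = a}"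

text \<open>The left translates of the neighbourhood basis at the identity are neighbourhood bases at
  the other points.\<close>

definition Sym_topology :: "perm topology" where
  "Sym_topology = topology (\<lambda>S. S \<subseteq> carrier Sym \<and>
     (\<forall>g\<in>S. \<exists>A. finite A \<and> A \<subseteq> Omega \<and> g <#\<^bsub>Sym\<^esub> pointwise_stab A \<subseteq> S))"

definition open_subgroup :: "perm set \<Rightarrow> bool" where
  "open_subgroup U \<longleftrightarrow> subgroup U Sym \<and> openin Sym_topology U"

abbreviation subgrp :: "perm set \<Rightarrow> perm monoid" where
  "subgrp U \<equiv> Sym\<lparr>carrier := U\<rparr>"


section \<open>Sets with a germ of a smooth action\<close>

text \<open>A \<open>hat_set\<close> is represented by a set with an action of one group of definition. Shrinking
  that group gives a different record, but an isomorphic one in the sense of \<open>hat_iso\<close> below.\<close>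

record 'x hset =
  defgrp :: "perm set"
  points :: "'x set"
  act :: "perm \<Rightarrow> 'x \<Rightarrow> 'x"

definition hat_set :: "'x hset \<Rightarrow> bool" where
  "hat_set X \<longleftrightarrow> open_subgroup (defgrp X) \<and>
     group_action (subgrp (defgrp X)) (points X) (act X) \<and>
     (\<forall>x\<in>points X. open_subgroup (stabilizer (subgrp (defgrp X)) (act X) x))"

definition finitary :: "'x hset \<Rightarrow> bool" where
  "finitary X \<longleftrightarrow> hat_set X \<and> finite (orbits (subgrp (defgrp X)) (points X) (act X))"

definition hat_map :: "'x hset \<Rightarrow> 'y hset \<Rightarrow> ('x \<Rightarrow> 'y) \<Rightarrow> bool" where
  "hat_map X Y f \<longleftrightarrow> f \<in> points X \<rightarrow> points Y \<and>
     (\<exists>W. open_subgroup W \<and> W \<subseteq> defgrp X \<and> W \<subseteq> defgrp Y \<and>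
        (\<forall>g\<in>W. \<forall>x\<in>points X. f (act X g x) = act Y g (f x)))"

definition hat_iso :: "'x hset \<Rightarrow> 'y hset \<Rightarrow> bool" where
  "hat_iso X Y \<longleftrightarrow> (\<exists>f. hat_map X Y f \<and> bij_betw f (points X) (points Y))"

definition hat_sum :: "'x hset \<Rightarrow> 'y hset \<Rightarrow> ('x + 'y) hset" where
  "hat_sum X Y =
     \<lparr>defgrp = defgrp X \<inter> defgrp Y,
      points = Sum_Type.Plus (points X) (points Y),
      act = (\<lambda>g. \<lambda>z \<in> Sum_Type.Plus (points X) (points Y). map_sum (act X g) (act Y g) z)\<rparr>"

definition hat_conj :: "'x hset \<Rightarrow> perm \<Rightarrow> 'x hset" where
  "hat_conj X g =
     \<lparr>defgrp = g <#\<^bsub>Sym\<^esub> defgrp X #>\<^bsub>Sym\<^esub> (inv\<^bsub>Sym\<^esub> g),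
      points = points X,
      act = (\<lambda>h. act X (inv\<^bsub>Sym\<^esub> g \<otimes>\<^bsub>Sym\<^esub> h \<otimes>\<^bsub>Sym\<^esub> g))\<rparr>"

definition hat_transitive :: "'x hset \<Rightarrow> bool" where
  "hat_transitive X \<longleftrightarrow> points X \<noteq> {} \<and>
     transitive_action (subgrp (defgrp X)) (points X) (act X)"

text \<open>The fibre of \<open>f\<close> over \<open>y\<close>; it carries an action of the stabilizer of \<open>y\<close> only.\<close>

definition hat_fiber :: "'x hset \<Rightarrow> 'y hset \<Rightarrow> ('x \<Rightarrow> 'y) \<Rightarrow> 'y \<Rightarrow> 'x hset" where
  "hat_fiber X Y f y =
     \<lparr>defgrp = stabilizer (subgrp (defgrp Y)) (act Y) y,
      points = {x \<in> points X. f x = y},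
      act = (\<lambda>g. restrict (act X g) {x \<in> points X. f x = y})\<rparr>"

definition Omega_sets :: "nat \<Rightarrow> nat set hset" where
  "Omega_sets n =
     \<lparr>defgrp = carrier Sym,
      points = nsets Omega n,
      act = (\<lambda>g. \<lambda>A \<in> nsets Omega n. g ` A)\<rparr>"


section \<open>The ring Theta\<close>

text \<open>Finitely supported integer functions on multisets of symbols, that is, polynomials with
  integer coefficients whose variables are the finitary hat-sets with points in \<open>'x\<close>.
  The type \<open>nat set\<close> is a large enough universe: by \<open>finitary_hat_iso_nat_set\<close> below, every
  finitary hat-set is isomorphic to one whose points are sets of natural numbers.\<close>

definition free_ring :: "('x hset multiset \<Rightarrow>\<^sub>0 int) ring" where
  "free_ring = ring_of_type_algebra
     \<lparr>carrier := {p. \<forall>m\<in>Poly_Mapping.keys p. \<forall>X\<in>#m. finitary X}\<rparr>"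

definition symbol :: "'x hset \<Rightarrow> ('x hset multiset \<Rightarrow>\<^sub>0 int)" where
  "symbol X = Poly_Mapping.single {#X#} 1"

inductive_set relators :: "('x hset multiset \<Rightarrow>\<^sub>0 int) set" where
  iso: "finitary X \<Longrightarrow> finitary Y \<Longrightarrow> hat_iso X Y \<Longrightarrow> symbol X - symbol Y \<in> relators"
| singleton: "finitary X \<Longrightarrow> points X = {x} \<Longrightarrow> symbol X - 1 \<in> relators"
| sum: "finitary X \<Longrightarrow> finitary Y \<Longrightarrow> finitary Z \<Longrightarrow> hat_iso Z (hat_sum X Y) \<Longrightarrow>
    symbol Z - (symbol X + symbol Y) \<in> relators"
| conj: "finitary X \<Longrightarrow> g \<in> carrier Sym \<Longrightarrow> symbol X - symbol (hat_conj X g) \<in> relators"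
| fiber: "hat_set X \<Longrightarrow> hat_set Y \<Longrightarrow> defgrp X = defgrp Y \<Longrightarrow> hat_transitive X \<Longrightarrow> hat_transitive Y \<Longrightarrow>
    f \<in> points X \<rightarrow> points Y \<Longrightarrow>
    (\<forall>g\<in>defgrp X. \<forall>x\<in>points X. f (act X g x) = act Y g (f x)) \<Longrightarrow> y \<in> points Y \<Longrightarrow>
    symbol X - symbol (hat_fiber X Y f y) * symbol Y \<in> relators"

definition Theta :: "('x hset multiset \<Rightarrow>\<^sub>0 int) set ring" where
  "Theta = free_ring Quot (Idl\<^bsub>free_ring\<^esub> relators)"

definition hclass :: "'x hset \<Rightarrow> ('x hset multiset \<Rightarrow>\<^sub>0 int) set" where
  "hclass X = (Idl\<^bsub>free_ring\<^esub> relators) +>\<^bsub>free_ring\<^esub> symbol X"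


section \<open>Integer-valued polynomials\<close>

definition int_valued_polys :: "rat poly ring" where
  "int_valued_polys = ring_of_type_algebra
     \<lparr>carrier := {p. \<forall>m::int. poly p (of_int m) \<in> \<int>}\<rparr>"

definition binomial_poly :: "nat \<Rightarrow> rat poly" where
  "binomial_poly n = smult (1 / fact n) (\<Prod>i<n. [:- of_nat i, 1:])"

lemma poly_binomial_poly: "poly (binomial_poly n) x = x gchoose n"
  by (simp add: binomial_poly_def poly_prod gbinomial_prod_rev atLeast0LessThan field_simps)


section \<open>Consistency of the definitions\<close>

lemma Sym_group: "group Sym"
  by (simp add: Sym_def group_BijGroup)

lemma Sym_mult: "g \<in> carrier Sym \<Longrightarrow> h \<in> carrier Sym \<Longrightarrow> a \<in> Omega \<Longrightarrow>
   (g \<otimes>\<^bsub>Sym\<^esub> h) a = g (h a)"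
  by (auto simp: Sym_def BijGroup_def compose_def)

lemma Sym_one: "a \<in> Omega \<Longrightarrow> \<one>\<^bsub>Sym\<^esub> a = a"
  by (simp add: Sym_def BijGroup_def)

lemma Sym_closed: "g \<in> carrier Sym \<Longrightarrow> a \<in> Omega \<Longrightarrow> g a \<in> Omega"
  by (auto simp: Sym_def BijGroup_def Bij_def bij_betw_def)

lemma pointwise_stab_Un: "pointwise_stab (A \<union> B) = pointwise_stab A \<inter> pointwise_stab B"
  by (auto simp: pointwise_stab_def)

lemma openin_Sym_topology:
  "openin Sym_topology S \<longleftrightarrow> S \<subseteq> carrier Sym \<and>
     (\<forall>g\<in>S. \<exists>A. finite A \<and> A \<subseteq> Omega \<and> g <#\<^bsub>Sym\<^esub> pointwise_stab A \<subseteq> S)"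
    (is "_ \<longleftrightarrow> ?L S")
proof -
  have 1: "?L (S \<inter> T)" if S: "?L S" and T: "?L T" for S T
  proof (intro conjI ballI)
    fix g assume g: "g \<in> S \<inter> T"
    obtain A B where "finite A" "A \<subseteq> Omega" "g <#\<^bsub>Sym\<^esub> pointwise_stab A \<subseteq> S"
      "finite B" "B \<subseteq> Omega" "g <#\<^bsub>Sym\<^esub> pointwise_stab B \<subseteq> T"
      using S T g by blast
    then show "\<exists>A. finite A \<and> A \<subseteq> Omega \<and> g <#\<^bsub>Sym\<^esub> pointwise_stab A \<subseteq> S \<inter> T"
      by (intro exI[of _ "A \<union> B"]) (auto simp: pointwise_stab_Un l_coset_def)
  qed (use S in blast)
  have 2: "?L (\<Union>K)" if "\<forall>S\<in>K. ?L S" for K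
    using that by (meson UnionE Union_least Union_upper subset_trans)
  have "istopology ?L"
    unfolding istopology_def using 1 2 by blast
  then show ?thesis
    by (simp add: Sym_topology_def topology_inverse')
qed

text \<open>For a subgroup, openness is openness at the identity.\<close>

lemma open_subgroup_iff:
  "open_subgroup U \<longleftrightarrow> subgroup U Sym \<and>
     (\<exists>A. finite A \<and> A \<subseteq> Omega \<and> pointwise_stab A \<subseteq> U)"
proof -
  interpret group Sym by (rule Sym_group)
  have "pointwise_stab A \<subseteq> carrier Sym" for A by (auto simp: pointwise_stab_def)
  then have 1: "\<one>\<^bsub>Sym\<^esub> <#\<^bsub>Sym\<^esub> pointwise_stab A = pointwise_stab A" for A
    by (simp add: lcos_mult_one)
  show ?thesis
  proof (cases "subgroup U Sym")
    case True
    interpret U: subgroup U Sym by fact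
    have "g <#\<^bsub>Sym\<^esub> pointwise_stab A \<subseteq> U" if "g \<in> U" "pointwise_stab A \<subseteq> U" for g A
      using that by (auto simp: l_coset_def)
    then show ?thesis
      unfolding open_subgroup_def openin_Sym_topology
      using True U.subset U.one_closed 1 by metis
  qed (simp add: open_subgroup_def)
qed

lemma open_subgroup_carrier: "open_subgroup (carrier Sym)"
  unfolding open_subgroup_iff
  using group.subgroup_self[OF Sym_group] by (auto simp: pointwise_stab_def)

lemma open_subgroup_Int: "open_subgroup U \<Longrightarrow> open_subgroup V \<Longrightarrow> open_subgroup (U \<inter> V)"
  unfolding open_subgroup_iff
  by (metis pointwise_stab_Un group.subgroups_Inter_pair Sym_group finite_UnI Un_least
      Int_mono)


lemma group_action_subgrpI:
  assumes U: "subgroup U Sym"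
    and ext: "\<And>g. g \<in> U \<Longrightarrow> \<phi> g \<in> extensional E"
    and closed: "\<And>g x. g \<in> U \<Longrightarrow> x \<in> E \<Longrightarrow> \<phi> g x \<in> E"
    and one: "\<And>x. x \<in> E \<Longrightarrow> \<phi> \<one>\<^bsub>Sym\<^esub> x = x"
    and mult: "\<And>g h x. g \<in> U \<Longrightarrow> h \<in> U \<Longrightarrow> x \<in> E \<Longrightarrow> \<phi> (g \<otimes>\<^bsub>Sym\<^esub> h) x = \<phi> g (\<phi> h x)"
  shows "group_action (subgrp U) E \<phi>"
proof -
  interpret U: subgroup U Sym by fact
  interpret group Sym by (rule Sym_group)
  have bij: "\<phi> g \<in> Bij E" if "g \<in> U" for g
  proof -
    have "bij_betw (\<phi> g) E E"
    proof (rule bij_betwI[of _ _ _ "\<phi> (inv\<^bsub>Sym\<^esub> g)"])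
      show "\<phi> (inv\<^bsub>Sym\<^esub> g) (\<phi> g x) = x" if "x \<in> E" for x
        using that \<open>g \<in> U\<close> mult[of "inv\<^bsub>Sym\<^esub> g" g x] one U.subset by (simp add: subset_iff)
      show "\<phi> g (\<phi> (inv\<^bsub>Sym\<^esub> g) x) = x" if "x \<in> E" for x
        using that \<open>g \<in> U\<close> mult[of g "inv\<^bsub>Sym\<^esub> g" x] one U.subset by (simp add: subset_iff)
    qed (use that closed in auto)
    then show ?thesis by (simp add: Bij_def ext that)
  qed
  have "\<phi> (g \<otimes>\<^bsub>Sym\<^esub> h) = compose E (\<phi> g) (\<phi> h)" if "g \<in> U" "h \<in> U" for g h
    using that ext[of "g \<otimes>\<^bsub>Sym\<^esub> h"]
    by (auto simp: compose_def mult fun_eq_iff extensional_def)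
  then have "\<phi> \<in> hom (subgrp U) (BijGroup E)"
    using bij by (auto simp: hom_def BijGroup_def)
  then show ?thesis
    unfolding group_action_def group_hom_def group_hom_axioms_def
    using U.subgroup_is_group group_BijGroup Sym_group by blast
qed

lemma group_action_subgrpD:
  assumes "group_action (subgrp U) E \<phi>"
  shows "g \<in> U \<Longrightarrow> \<phi> g \<in> extensional E"
    and "g \<in> U \<Longrightarrow> x \<in> E \<Longrightarrow> \<phi> g x \<in> E"
    and "x \<in> E \<Longrightarrow> \<phi> \<one>\<^bsub>Sym\<^esub> x = x"
    and "g \<in> U \<Longrightarrow> h \<in> U \<Longrightarrow> x \<in> E \<Longrightarrow> \<phi> (g \<otimes>\<^bsub>Sym\<^esub> h) x = \<phi> g (\<phi> h x)"
proof -
  interpret group_action "subgrp U" E \<phi> by fact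
  interpret group_hom "subgrp U" "BijGroup E" \<phi> by (rule group_hom)
  have bij: "\<phi> g \<in> Bij E" if "g \<in> U" for g
    using hom_closed[of g] that by (simp add: BijGroup_def)
  show "g \<in> U \<Longrightarrow> \<phi> g \<in> extensional E"
    and closed: "g \<in> U \<Longrightarrow> x \<in> E \<Longrightarrow> \<phi> g x \<in> E"
    using bij[of g] by (auto simp: Bij_def bij_betw_def)
  show "x \<in> E \<Longrightarrow> \<phi> \<one>\<^bsub>Sym\<^esub> x = x"
    using hom_one by (simp add: BijGroup_def)
  show "g \<in> U \<Longrightarrow> h \<in> U \<Longrightarrow> x \<in> E \<Longrightarrow> \<phi> (g \<otimes>\<^bsub>Sym\<^esub> h) x = \<phi> g (\<phi> h x)"
    using hom_mult[of g h] bij[of g] bij[of h] by (simp add: BijGroup_def compose_def)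
qed

lemma Sym_cancel:
  assumes "g \<in> carrier Sym" "h \<in> carrier Sym"
  shows "inv\<^bsub>Sym\<^esub> g \<otimes>\<^bsub>Sym\<^esub> (g \<otimes>\<^bsub>Sym\<^esub> h) = h" "g \<otimes>\<^bsub>Sym\<^esub> (inv\<^bsub>Sym\<^esub> g \<otimes>\<^bsub>Sym\<^esub> h) = h"
proof -
  interpret group Sym by (rule Sym_group)
  show "inv\<^bsub>Sym\<^esub> g \<otimes>\<^bsub>Sym\<^esub> (g \<otimes>\<^bsub>Sym\<^esub> h) = h" "g \<otimes>\<^bsub>Sym\<^esub> (inv\<^bsub>Sym\<^esub> g \<otimes>\<^bsub>Sym\<^esub> h) = h"
    using assms by (simp_all add: m_assoc[symmetric])
qed

lemma conj_simps:
  assumes "g \<in> carrier Sym" "h \<in> carrier Sym"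
  shows "inv\<^bsub>Sym\<^esub> g \<otimes>\<^bsub>Sym\<^esub> (g \<otimes>\<^bsub>Sym\<^esub> h \<otimes>\<^bsub>Sym\<^esub> inv\<^bsub>Sym\<^esub> g) \<otimes>\<^bsub>Sym\<^esub> g = h"
    and "g \<otimes>\<^bsub>Sym\<^esub> (inv\<^bsub>Sym\<^esub> g \<otimes>\<^bsub>Sym\<^esub> h \<otimes>\<^bsub>Sym\<^esub> g) \<otimes>\<^bsub>Sym\<^esub> inv\<^bsub>Sym\<^esub> g = h"
    and "inv\<^bsub>Sym\<^esub> g \<otimes>\<^bsub>Sym\<^esub> \<one>\<^bsub>Sym\<^esub> \<otimes>\<^bsub>Sym\<^esub> g = \<one>\<^bsub>Sym\<^esub>"
proof -
  interpret group Sym by (rule Sym_group)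
  show "inv\<^bsub>Sym\<^esub> g \<otimes>\<^bsub>Sym\<^esub> (g \<otimes>\<^bsub>Sym\<^esub> h \<otimes>\<^bsub>Sym\<^esub> inv\<^bsub>Sym\<^esub> g) \<otimes>\<^bsub>Sym\<^esub> g = h"
    and "g \<otimes>\<^bsub>Sym\<^esub> (inv\<^bsub>Sym\<^esub> g \<otimes>\<^bsub>Sym\<^esub> h \<otimes>\<^bsub>Sym\<^esub> g) \<otimes>\<^bsub>Sym\<^esub> inv\<^bsub>Sym\<^esub> g = h"
    and "inv\<^bsub>Sym\<^esub> g \<otimes>\<^bsub>Sym\<^esub> \<one>\<^bsub>Sym\<^esub> \<otimes>\<^bsub>Sym\<^esub> g = \<one>\<^bsub>Sym\<^esub>"
    using assms by (simp_all add: m_assoc Sym_cancel)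
qed

lemma conj_mult:
  assumes "g \<in> carrier Sym" "h \<in> carrier Sym" "k \<in> carrier Sym"
  shows "inv\<^bsub>Sym\<^esub> g \<otimes>\<^bsub>Sym\<^esub> (h \<otimes>\<^bsub>Sym\<^esub> k) \<otimes>\<^bsub>Sym\<^esub> g =
      (inv\<^bsub>Sym\<^esub> g \<otimes>\<^bsub>Sym\<^esub> h \<otimes>\<^bsub>Sym\<^esub> g) \<otimes>\<^bsub>Sym\<^esub> (inv\<^bsub>Sym\<^esub> g \<otimes>\<^bsub>Sym\<^esub> k \<otimes>\<^bsub>Sym\<^esub> g)"
proof -
  interpret group Sym by (rule Sym_group)
  show ?thesis
    using assms by (simp add: m_assoc Sym_cancel)
qed

lemma mem_conj_iff:
  assumes "U \<subseteq> carrier Sym" "g \<in> carrier Sym"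
  shows "h \<in> g <#\<^bsub>Sym\<^esub> U #>\<^bsub>Sym\<^esub> (inv\<^bsub>Sym\<^esub> g) \<longleftrightarrow>
    h \<in> carrier Sym \<and> inv\<^bsub>Sym\<^esub> g \<otimes>\<^bsub>Sym\<^esub> h \<otimes>\<^bsub>Sym\<^esub> g \<in> U"
    (is "?L \<longleftrightarrow> ?R")
proof
  interpret group Sym by (rule Sym_group)
  show "?L \<Longrightarrow> ?R"
    using assms by (auto simp: l_coset_def r_coset_def conj_simps subset_iff)
  assume R: ?R
  then have "h = g \<otimes>\<^bsub>Sym\<^esub> (inv\<^bsub>Sym\<^esub> g \<otimes>\<^bsub>Sym\<^esub> h \<otimes>\<^bsub>Sym\<^esub> g) \<otimes>\<^bsub>Sym\<^esub> inv\<^bsub>Sym\<^esub> g"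
    using assms(2) by (simp add: conj_simps)
  with R show ?L
    unfolding l_coset_def r_coset_def by blast
qed

lemma open_subgroup_conj:
  assumes U: "open_subgroup U" and g: "g \<in> carrier Sym"
  shows "open_subgroup (g <#\<^bsub>Sym\<^esub> U #>\<^bsub>Sym\<^esub> (inv\<^bsub>Sym\<^esub> g))"
proof -
  interpret group Sym by (rule Sym_group)
  have sub: "subgroup U Sym" using U by (simp add: open_subgroup_def)
  interpret U: subgroup U Sym by fact
  obtain A where A: "finite A" "A \<subseteq> Omega" "pointwise_stab A \<subseteq> U"
    using U by (auto simp: open_subgroup_iff)
  note mem = mem_conj_iff[OF U.subset g]
  have 1: "pointwise_stab (g ` A) \<subseteq> g <#\<^bsub>Sym\<^esub> U #>\<^bsub>Sym\<^esub> (inv\<^bsub>Sym\<^esub> g)"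
  proof
    fix h assume h: "h \<in> pointwise_stab (g ` A)"
    then have hc: "h \<in> carrier Sym" by (simp add: pointwise_stab_def)
    have "(inv\<^bsub>Sym\<^esub> g \<otimes>\<^bsub>Sym\<^esub> h \<otimes>\<^bsub>Sym\<^esub> g) a = a" if "a \<in> A" for a
    proof -
      have a: "a \<in> Omega" using that A by auto
      have "(inv\<^bsub>Sym\<^esub> g \<otimes>\<^bsub>Sym\<^esub> h \<otimes>\<^bsub>Sym\<^esub> g) a = (inv\<^bsub>Sym\<^esub> g) (h (g a))"
        using g hc a by (simp add: Sym_mult Sym_closed)
      also have "h (g a) = g a" using h that by (simp add: pointwise_stab_def)
      also have "(inv\<^bsub>Sym\<^esub> g) (g a) = (inv\<^bsub>Sym\<^esub> g \<otimes>\<^bsub>Sym\<^esub> g) a"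
        using g a Sym_mult[of "inv\<^bsub>Sym\<^esub> g" g a] inv_closed by metis
      finally show ?thesis using g a by (simp add: Sym_one)
    qed
    then have "inv\<^bsub>Sym\<^esub> g \<otimes>\<^bsub>Sym\<^esub> h \<otimes>\<^bsub>Sym\<^esub> g \<in> pointwise_stab A"
      using g hc by (simp add: pointwise_stab_def)
    then show "h \<in> g <#\<^bsub>Sym\<^esub> U #>\<^bsub>Sym\<^esub> (inv\<^bsub>Sym\<^esub> g)"
      using mem hc A by blast
  qed
  have "subgroup (g <#\<^bsub>Sym\<^esub> U #>\<^bsub>Sym\<^esub> (inv\<^bsub>Sym\<^esub> g)) Sym"
    by (rule subgroup_conjugation_is_surj2[OF g sub])
  then show ?thesis
    unfolding open_subgroup_iff using 1 A Sym_closed[OF g]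
    by (intro conjI exI[of _ "g ` A"]) auto
qed


lemma hat_setD:
  assumes "hat_set X"
  shows "open_subgroup (defgrp X)" "subgroup (defgrp X) Sym"
    "group_action (subgrp (defgrp X)) (points X) (act X)"
    "x \<in> points X \<Longrightarrow> open_subgroup {g \<in> defgrp X. act X g x = x}"
  using assms by (auto simp: hat_set_def open_subgroup_def stabilizer_def)

lemma hat_setI:
  assumes "open_subgroup (defgrp X)"
    and "group_action (subgrp (defgrp X)) (points X) (act X)"
    and "\<And>x. x \<in> points X \<Longrightarrow> open_subgroup {g \<in> defgrp X. act X g x = x}"
  shows "hat_set X"
  using assms by (auto simp: hat_set_def stabilizer_def)

lemma finitary_hat_conj:
  assumes fin: "finitary X" and g: "g \<in> carrier Sym"
  shows "finitary (hat_conj X g)"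
proof -
  interpret group Sym by (rule Sym_group)
  let ?c = "\<lambda>h. inv\<^bsub>Sym\<^esub> g \<otimes>\<^bsub>Sym\<^esub> h \<otimes>\<^bsub>Sym\<^esub> g"
  let ?U = "defgrp X" and ?V = "g <#\<^bsub>Sym\<^esub> defgrp X #>\<^bsub>Sym\<^esub> (inv\<^bsub>Sym\<^esub> g)"
  have X: "hat_set X" using fin by (simp add: finitary_def)
  note D = hat_setD[OF X]
  note A = group_action_subgrpD[OF D(3)]
  interpret U: subgroup ?U Sym by (rule D(2))
  have V: "open_subgroup ?V" by (rule open_subgroup_conj[OF D(1) g])
  then have subV: "subgroup ?V Sym" by (simp add: open_subgroup_def)
  note mem = mem_conj_iff[OF U.subset g]
  have act: "group_action (subgrp ?V) (points X) (\<lambda>h. act X (?c h))"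
  proof (rule group_action_subgrpI[OF subV])
    show "act X (?c (h \<otimes>\<^bsub>Sym\<^esub> k)) x = act X (?c h) (act X (?c k) x)"
      if "h \<in> ?V" "k \<in> ?V" "x \<in> points X" for h k x
      using that g by (simp add: mem conj_mult A(4))
  qed (use g A in \<open>auto simp: mem conj_simps\<close>)
  have hs: "hat_set (hat_conj X g)"
  proof (rule hat_setI)
    fix x assume "x \<in> points (hat_conj X g)"
    then have x: "x \<in> points X" by (simp add: hat_conj_def)
    have "{h \<in> ?V. act X (?c h) x = x} =
      g <#\<^bsub>Sym\<^esub> {u \<in> ?U. act X u x = x} #>\<^bsub>Sym\<^esub> (inv\<^bsub>Sym\<^esub> g)"
      using mem_conj_iff[of "{u \<in> ?U. act X u x = x}", OF _ g] U.subset
      by (auto simp: mem)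
    then show "open_subgroup {h \<in> defgrp (hat_conj X g). act (hat_conj X g) h x = x}"
      using open_subgroup_conj[OF D(4)[OF x] g] by (simp add: hat_conj_def)
  qed (use V act in \<open>simp_all add: hat_conj_def\<close>)
  have surj: "\<exists>h\<in>?V. ?c h = u" if "u \<in> ?U" for u
  proof (rule bexI)
    have u: "u \<in> carrier Sym" using that U.subset by blast
    show eq: "?c (g \<otimes>\<^bsub>Sym\<^esub> u \<otimes>\<^bsub>Sym\<^esub> inv\<^bsub>Sym\<^esub> g) = u"
      using g u by (simp add: conj_simps)
    show "g \<otimes>\<^bsub>Sym\<^esub> u \<otimes>\<^bsub>Sym\<^esub> inv\<^bsub>Sym\<^esub> g \<in> ?V"
      unfolding mem eq using that u g by simp
  qed
  have "orbit (subgrp ?V) (\<lambda>h. act X (?c h)) x = orbit (subgrp ?U) (act X) x" for x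
  proof
    show "orbit (subgrp ?V) (\<lambda>h. act X (?c h)) x \<subseteq> orbit (subgrp ?U) (act X) x"
      using mem by (auto simp: orbit_def)
    show "orbit (subgrp ?U) (act X) x \<subseteq> orbit (subgrp ?V) (\<lambda>h. act X (?c h)) x"
    proof
      fix z assume "z \<in> orbit (subgrp ?U) (act X) x"
      then obtain u where "u \<in> ?U" "z = act X u x" by (auto simp: orbit_def)
      moreover obtain h where "h \<in> ?V" "?c h = u" using surj[OF \<open>u \<in> ?U\<close>] by blast
      ultimately show "z \<in> orbit (subgrp ?V) (\<lambda>h. act X (?c h)) x"
        unfolding orbit_def by (simp, blast)
    qed
  qed
  then have "orbits (subgrp ?V) (points X) (\<lambda>h. act X (?c h)) = orbits (subgrp ?U) (points X) (act X)"
    by (simp add: orbits_def)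
  then show ?thesis
    using fin hs by (simp add: finitary_def hat_conj_def)
qed

lemma finitary_transitive:
  assumes "hat_set X" "hat_transitive X"
  shows "finitary X"
proof -
  let ?G = "subgrp (defgrp X)"
  interpret transitive_action ?G "points X" "act X"
    using assms by (simp add: hat_transitive_def)
  note A = group_action_subgrpD[OF hat_setD(3)[OF assms(1)]]
  have "orbit ?G (act X) x = points X" if "x \<in> points X" for x
    using A(2) unique_orbit[OF that] that by (fastforce simp: orbit_def)
  then have "orbits ?G (points X) (act X) \<subseteq> {points X}"
    by (auto simp: orbits_def)
  then show ?thesis
    using assms(1) finite_subset by (auto simp: finitary_def)
qed

lemma finitary_hat_fiber:
  assumes X: "hat_set X" and Y: "hat_set Y" and grp: "defgrp X = defgrp Y"
    and tr: "hat_transitive X" "hat_transitive Y"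
    and f: "f \<in> points X \<rightarrow> points Y"
    and eqv: "\<forall>g\<in>defgrp X. \<forall>x\<in>points X. f (act X g x) = act Y g (f x)"
    and y: "y \<in> points Y"
  shows "finitary (hat_fiber X Y f y)"
proof -
  let ?U = "defgrp Y" and ?S = "{g \<in> defgrp Y. act Y g y = y}"
  let ?F = "{x \<in> points X. f x = y}"
  let ?a = "\<lambda>g. restrict (act X g) ?F"
  note D = hat_setD[OF X, unfolded grp]
  note A = group_action_subgrpD[OF D(3)]
  have S: "open_subgroup ?S" by (rule hat_setD(4)[OF Y y])
  then have subS: "subgroup ?S Sym" by (simp add: open_subgroup_def)
  interpret S: subgroup ?S Sym by (rule subS)
  have closed: "act X g x \<in> ?F" if "g \<in> ?S" "x \<in> ?F" for g x
    using that eqv A(2) by (auto simp: grp)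
  have act: "group_action (subgrp ?S) ?F ?a"
    using subS
  proof (rule group_action_subgrpI)
    show "?a (g \<otimes>\<^bsub>Sym\<^esub> h) x = ?a g (?a h x)" if "g \<in> ?S" "h \<in> ?S" "x \<in> ?F" for g h x
      using closed[OF that(2,3)] that A(4) by simp
  qed (use closed A(3) in auto)
  have fib: "hat_fiber X Y f y = \<lparr>defgrp = ?S, points = ?F, act = ?a\<rparr>"
    by (simp add: hat_fiber_def stabilizer_def)
  have hs: "hat_set (hat_fiber X Y f y)"
    unfolding fib
  proof (rule hat_setI; simp only: hset.simps)
    fix x assume x: "x \<in> ?F"
    have "{g \<in> ?S. ?a g x = x} = {g \<in> ?U. act X g x = x}"
    proof -
      have "act Y g y = y" if "g \<in> ?U" "act X g x = x" for g
        using bspec[OF bspec[OF eqv, of g], of x] x that by (simp add: grp)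
      then show ?thesis using x by auto
    qed
    then show "open_subgroup {g \<in> ?S. ?a g x = x}"
      using D(4) x by simp
  qed (use S act in auto)
  have "act X g x = z \<Longrightarrow> g \<in> ?U \<Longrightarrow> x \<in> ?F \<Longrightarrow> z \<in> ?F \<Longrightarrow> g \<in> ?S" for g x z
    using eqv by (auto simp: grp)
  moreover have "\<exists>g\<in>?U. act X g x = z" if "x \<in> ?F" "z \<in> ?F" for x z
    using transitive_action.unique_orbit[of "subgrp ?U" "points X" "act X" x z] tr(1) that
    by (simp add: hat_transitive_def grp)
  ultimately have "\<exists>g\<in>?S. ?a g x = z" if "x \<in> ?F" "z \<in> ?F" for x z
    using that by (metis (no_types, lifting) restrict_apply')
  moreover have "?F \<noteq> {}"
  proof -
    obtain x where x: "x \<in> points X" using tr by (auto simp: hat_transitive_def)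
    then have "f x \<in> points Y" using f by auto
    then obtain g where "g \<in> ?U" "act Y g (f x) = y"
      using transitive_action.unique_orbit[of "subgrp ?U" "points Y" "act Y" "f x" y] tr(2) y
      by (auto simp: hat_transitive_def)
    then have "act X g x \<in> ?F" using x eqv A(2) by (simp add: grp)
    then show ?thesis by blast
  qed
  ultimately have "hat_transitive (hat_fiber X Y f y)"
    unfolding hat_transitive_def fib transitive_action_def transitive_action_axioms_def
    using act by simp
  with hs show ?thesis by (rule finitary_transitive)
qed

lemma free_ring_simps [simp]:
  "carrier free_ring = {p. \<forall>m\<in>Poly_Mapping.keys p. \<forall>X\<in>#m. finitary X}"
  "p \<otimes>\<^bsub>free_ring\<^esub> q = p * q" "p \<oplus>\<^bsub>free_ring\<^esub> q = p + q"
  "\<zero>\<^bsub>free_ring\<^esub> = 0" "\<one>\<^bsub>free_ring\<^esub> = 1"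
  by (simp_all add: free_ring_def ring_of_type_algebra_def)

lemma free_ring_closed:
  "1 \<in> carrier free_ring"
  "finitary X \<Longrightarrow> symbol X \<in> carrier free_ring"
  "p \<in> carrier free_ring \<Longrightarrow> q \<in> carrier free_ring \<Longrightarrow> p + q \<in> carrier free_ring"
  "p \<in> carrier free_ring \<Longrightarrow> q \<in> carrier free_ring \<Longrightarrow> p - q \<in> carrier free_ring"
  "p \<in> carrier free_ring \<Longrightarrow> q \<in> carrier free_ring \<Longrightarrow> p * q \<in> carrier free_ring"
proof -
  show "p + q \<in> carrier free_ring" if "p \<in> carrier free_ring" "q \<in> carrier free_ring"
    using that Poly_Mapping.keys_add[of p q] by auto
  show "p - q \<in> carrier free_ring" if "p \<in> carrier free_ring" "q \<in> carrier free_ring"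
    using that keys_diff[of p q] by auto
  show "p * q \<in> carrier free_ring" if "p \<in> carrier free_ring" "q \<in> carrier free_ring"
    using that keys_mult[of p q] by fastforce
qed (auto simp: symbol_def)

lemma cring_free_ring: "cring (free_ring :: ('x hset multiset \<Rightarrow>\<^sub>0 int) ring)" (is "cring ?R")
proof (rule cringI)
  show "abelian_group ?R"
  proof (rule abelian_groupI)
    fix x :: "'x hset multiset \<Rightarrow>\<^sub>0 int" assume x: "x \<in> carrier free_ring"
    show "\<exists>y\<in>carrier free_ring. y \<oplus>\<^bsub>free_ring\<^esub> x = \<zero>\<^bsub>free_ring\<^esub>"
      using x by (intro bexI[of _ "- x"]) simp_all
  qed (auto simp del: free_ring_simps(1) simp: free_ring_closed algebra_simps, simp)
  show "comm_monoid ?R"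
    by (rule comm_monoidI)
       (auto simp del: free_ring_simps(1) simp: free_ring_closed algebra_simps)
qed (simp add: algebra_simps)

text \<open>\<open>genideal\<close> is an intersection of ideals containing the given set, so it needs this inclusion.\<close>

lemma relators_subset: "relators \<subseteq> carrier free_ring"
proof
  fix r :: "'a hset multiset \<Rightarrow>\<^sub>0 int" assume "r \<in> relators"
  then show "r \<in> carrier free_ring"
  proof cases
    case (conj X g)
    show ?thesis
      unfolding conj(1)
      using finitary_hat_conj[OF conj(2,3)] conj(2) by (intro free_ring_closed)
  next
    case (fiber X Y f y)
    have "finitary X" "finitary Y" "finitary (hat_fiber X Y f y)"
      by (rule finitary_transitive[OF fiber(2,5)] finitary_transitive[OF fiber(3,6)]
          finitary_hat_fiber[OF fiber(2-9)])+
    then show ?thesis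
      unfolding fiber(1) by (intro free_ring_closed)
  qed (simp_all only: free_ring_closed)
qed

lemma countable_points:
  assumes "finitary X"
  shows "countable (points X)"
proof -
  let ?G = "subgrp (defgrp X)"
  interpret group Sym by (rule Sym_group)
  have X: "hat_set X" using assms by (simp add: finitary_def)
  note D = hat_setD[OF X]
  note A = group_action_subgrpD[OF D(3)]
  interpret U: subgroup "defgrp X" Sym by (rule D(2))
  have "countable (orbit ?G (act X) x)" if x: "x \<in> points X" for x
  proof -
    obtain A where fin: "finite A" "A \<subseteq> Omega"
      and stab: "pointwise_stab A \<subseteq> {g \<in> defgrp X. act X g x = x}"
      using D(4)[OF x] by (auto simp: open_subgroup_iff)
    have set: "set (sorted_list_of_set A) = A" using fin by simp
    define r where "r g = map g (sorted_list_of_set A)" for g :: perm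
    have eq: "act X g x = act X h x"
      if gh: "g \<in> defgrp X" "h \<in> defgrp X" "r g = r h" for g h
    proof -
      have gc: "g \<in> carrier Sym" "h \<in> carrier Sym" using gh U.subset by auto
      have "(inv\<^bsub>Sym\<^esub> g \<otimes>\<^bsub>Sym\<^esub> h) a = a" if "a \<in> A" for a
      proof -
        have a: "a \<in> Omega" using that fin by auto
        have "(inv\<^bsub>Sym\<^esub> g \<otimes>\<^bsub>Sym\<^esub> h) a = (inv\<^bsub>Sym\<^esub> g) (h a)"
          using gc a by (simp add: Sym_mult)
        also have "h a = g a" using gh(3) that set by (metis map_eq_conv r_def)
        also have "(inv\<^bsub>Sym\<^esub> g) (g a) = (inv\<^bsub>Sym\<^esub> g \<otimes>\<^bsub>Sym\<^esub> g) a"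
          using gc a Sym_mult[of "inv\<^bsub>Sym\<^esub> g" g a] inv_closed by metis
        finally show ?thesis using gc a by (simp add: Sym_one)
      qed
      then have "inv\<^bsub>Sym\<^esub> g \<otimes>\<^bsub>Sym\<^esub> h \<in> pointwise_stab A"
        using gc by (simp add: pointwise_stab_def)
      then have k: "inv\<^bsub>Sym\<^esub> g \<otimes>\<^bsub>Sym\<^esub> h \<in> defgrp X" "act X (inv\<^bsub>Sym\<^esub> g \<otimes>\<^bsub>Sym\<^esub> h) x = x"
        using stab by auto
      have "h = g \<otimes>\<^bsub>Sym\<^esub> (inv\<^bsub>Sym\<^esub> g \<otimes>\<^bsub>Sym\<^esub> h)"
        using gc by (simp add: Sym_cancel)
      then show ?thesis using A(4)[OF gh(1) k(1) x] k(2) by metis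
    qed
    have c: "countable (r ` defgrp X)" by (rule countableI_type)
    have "act X g x = act X (inv_into (defgrp X) r (r g)) x" if g: "g \<in> defgrp X" for g
      proof (rule eq[OF g])
      show "inv_into (defgrp X) r (r g) \<in> defgrp X" using g by (intro inv_into_into imageI)
      show "r g = r (inv_into (defgrp X) r (r g))"
        using f_inv_into_f[of "r g" r "defgrp X"] g by simp
    qed
    then have "orbit ?G (act X) x \<subseteq> (\<lambda>t. act X (inv_into (defgrp X) r t) x) ` r ` defgrp X"
      by (auto simp: orbit_def image_iff)
    then show ?thesis using c countable_image countable_subset by blast
  qed
  then have "countable S" if "S \<in> orbits ?G (points X) (act X)" for S
    using that by (auto simp: orbits_def)
  moreover have "countable (orbits ?G (points X) (act X))"
    using assms by (simp add: finitary_def countable_finite)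
  ultimately have "countable (\<Union>(orbits ?G (points X) (act X)))"
    using countable_UN[of "orbits ?G (points X) (act X)" "\<lambda>S. S"] by simp
  moreover have "x \<in> orbit ?G (act X) x" if "x \<in> points X" for x
    unfolding orbit_def using A(3)[OF that] U.one_closed by (simp, metis)
  then have "points X \<subseteq> \<Union>(orbits ?G (points X) (act X))"
    by (auto simp: orbits_def)
  ultimately show ?thesis by (rule countable_subset[rotated])
qed

text \<open>No finitary hat-set is lost by taking the points to be sets of natural numbers.\<close>

lemma finitary_hat_iso_nat_set:
  fixes X :: "'x hset"
  assumes X: "finitary X"
  shows "\<exists>Y :: nat set hset. finitary Y \<and> hat_iso X Y"
proof -
  obtain e :: "'x \<Rightarrow> nat" where e: "inj_on e (points X)"
    using countable_points[OF X] by (auto simp: countable_def)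
  define f where "f x = {e x}" for x
  have f: "inj_on f (points X)" using e by (auto simp: inj_on_def f_def)
  let ?i = "inv_into (points X) f"
  let ?a = "\<lambda>g. \<lambda>z \<in> f ` points X. f (act X g (?i z))"
  define Y where "Y = \<lparr>defgrp = defgrp X, points = f ` points X, act = ?a\<rparr>"
  have hs: "hat_set X" using X by (simp add: finitary_def)
  note D = hat_setD[OF hs]
  note A = group_action_subgrpD[OF D(3)]
  interpret U: subgroup "defgrp X" Sym by (rule D(2))
  have act: "group_action (subgrp (defgrp X)) (f ` points X) ?a"
    by (rule group_action_subgrpI[OF D(2)]) (use f A in auto)
  have hY: "hat_set Y"
  proof (rule hat_setI)
    fix z assume "z \<in> points Y"
    then obtain x where x: "x \<in> points X" "z = f x" by (auto simp: Y_def)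
    then have "{g \<in> defgrp Y. act Y g z = z} = {g \<in> defgrp X. act X g x = x}"
      using f A(2) by (auto simp: Y_def inj_on_eq_iff)
    then show "open_subgroup {g \<in> defgrp Y. act Y g z = z}" using D(4) x by simp
  qed (use D act in \<open>simp_all add: Y_def\<close>)
  have "orbit (subgrp (defgrp X)) ?a (f x) = f ` orbit (subgrp (defgrp X)) (act X) x"
    if "x \<in> points X" for x
    using that f by (auto simp: orbit_def)
  then have "orbits (subgrp (defgrp X)) (f ` points X) ?a \<subseteq>
    (`) f ` orbits (subgrp (defgrp X)) (points X) (act X)"
    by (auto simp: orbits_def)
  moreover have "finite ((`) f ` orbits (subgrp (defgrp X)) (points X) (act X))"
    using X by (simp add: finitary_def)
  ultimately have "finite (orbits (subgrp (defgrp X)) (f ` points X) ?a)"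
    by (rule finite_subset)
  with hY have "finitary Y"
    by (simp add: finitary_def Y_def)
  moreover have "hat_iso X Y"
    unfolding hat_iso_def hat_map_def using D(1) f
    by (intro exI[of _ f] conjI exI[of _ "defgrp X"]) (auto simp: Y_def bij_betw_def)
  ultimately show ?thesis by blast
qed


lemma Sym_transitive_on_nsets:
  assumes A: "A \<in> nsets Omega n" and B: "B \<in> nsets Omega n"
  shows "\<exists>g\<in>carrier Sym. g ` A = B"
proof -
  let ?C = "A \<union> B"
  have fin: "finite A" "finite B" "card A = card B" "A \<subseteq> Omega" "B \<subseteq> Omega"
    using A B by (auto simp: nsets_def)
  obtain p where p: "bij_betw p A B"
    using fin finite_same_card_bij by blast
  have "card (?C - A) = card (?C - B)" using fin by (simp add: card_Diff_subset)
  then obtain q where q: "bij_betw q (?C - A) (?C - B)"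
    using fin finite_same_card_bij[of "?C - A" "?C - B"] by auto
  define r where "r x = (if x \<in> A then p x else q x)" for x
  define g where "g = (\<lambda>x\<in>Omega. if x \<in> ?C then r x else x)"
  have "bij_betw r A B"
    using p by (subst bij_betw_cong[of _ _ p]) (auto simp: r_def)
  moreover have "bij_betw r (?C - A) (?C - B)"
    using q by (subst bij_betw_cong[of _ _ q]) (auto simp: r_def)
  ultimately have "bij_betw r (A \<union> (?C - A)) (B \<union> (?C - B))"
    by (rule bij_betw_combine) auto
  moreover have "A \<union> (?C - A) = ?C" "B \<union> (?C - B) = ?C" by auto
  ultimately have r: "bij_betw r ?C ?C" by simp
  have "bij_betw g ?C ?C"
    using r fin by (subst bij_betw_cong[of _ _ r]) (auto simp: g_def)
  moreover have "bij_betw g (Omega - ?C) (Omega - ?C)"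
    by (subst bij_betw_cong[of _ _ id]) (auto simp: g_def)
  ultimately have "bij_betw g (?C \<union> (Omega - ?C)) (?C \<union> (Omega - ?C))"
    by (rule bij_betw_combine) auto
  moreover have "?C \<union> (Omega - ?C) = Omega" using fin by auto
  ultimately have "g \<in> carrier Sym"
    by (simp add: Sym_def BijGroup_def Bij_def g_def)
  moreover have "g ` A = p ` A"
    using fin by (intro image_cong) (auto simp: g_def r_def)
  then have "g ` A = B" using p by (simp add: bij_betw_def)
  ultimately show ?thesis by blast
qed

lemma finitary_Omega_sets: "finitary (Omega_sets n)"
proof -
  let ?E = "nsets Omega n"
  let ?a = "\<lambda>g :: perm. \<lambda>A \<in> ?E. g ` A"
  note sub = group.subgroup_self[OF Sym_group]
  have closed: "g ` A \<in> ?E" if g: "g \<in> carrier Sym" and A: "A \<in> ?E" for g A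
  proof -
    have "inj_on g Omega" using g by (simp add: Sym_def BijGroup_def Bij_def bij_betw_def)
    then have "inj_on g A" using A by (auto simp: nsets_def intro: inj_on_subset)
    then show ?thesis using A Sym_closed[OF g] by (auto simp: nsets_def card_image)
  qed
  have act: "group_action (subgrp (carrier Sym)) ?E ?a"
    using sub
  proof (rule group_action_subgrpI)
    show "?a \<one>\<^bsub>Sym\<^esub> A = A" if "A \<in> ?E" for A
    proof -
      have "\<one>\<^bsub>Sym\<^esub> ` A = id ` A"
        using that by (intro image_cong) (auto simp: nsets_def Sym_one)
      then show ?thesis using that by simp
    qed
    show "?a (g \<otimes>\<^bsub>Sym\<^esub> h) A = ?a g (?a h A)"
      if "g \<in> carrier Sym" "h \<in> carrier Sym" "A \<in> ?E" for g h A
    proof -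
      have "(g \<otimes>\<^bsub>Sym\<^esub> h) ` A = (\<lambda>a. g (h a)) ` A"
        using that by (intro image_cong) (auto simp: nsets_def Sym_mult)
      then show ?thesis using that closed by (simp add: image_image)
    qed
  qed (use closed in auto)
  have hs: "hat_set (Omega_sets n)"
  proof (rule hat_setI)
    fix A assume "A \<in> points (Omega_sets n)"
    then have A: "A \<in> ?E" by (simp add: Omega_sets_def)
    interpret group_action "subgrp (carrier Sym)" ?E ?a by (rule act)
    have "subgroup {g \<in> carrier Sym. ?a g A = A} Sym"
      using stabilizer_subgroup[OF A] by (simp add: stabilizer_def)
    moreover have "pointwise_stab A \<subseteq> {g \<in> carrier Sym. ?a g A = A}"
      using A by (auto simp: pointwise_stab_def image_iff)
    moreover have "finite A" "A \<subseteq> Omega" using A by (auto simp: nsets_def)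
    ultimately have "open_subgroup {g \<in> carrier Sym. ?a g A = A}"
      unfolding open_subgroup_iff by blast
    then show "open_subgroup {g \<in> defgrp (Omega_sets n). act (Omega_sets n) g A = A}"
      by (simp add: Omega_sets_def)
  qed (use act open_subgroup_carrier in \<open>simp_all add: Omega_sets_def\<close>)
  have "{1..n} \<in> ?E" by (auto simp: nsets_def Omega_def)
  then have "?E \<noteq> {}" by blast
  moreover have "transitive_action (subgrp (carrier Sym)) ?E ?a"
    unfolding transitive_action_def transitive_action_axioms_def
    using act Sym_transitive_on_nsets[of _ n] by simp
  ultimately have "hat_transitive (Omega_sets n)"
    by (simp add: hat_transitive_def Omega_sets_def)
  with hs show ?thesis by (rule finitary_transitive)
qed

end

theory Submission
  imports Defs
begin

text \<open>The inverse of the isomorphism counts fixed points. For a finitary hat-set \<open>X\<close> and all large \<open>n\<close>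
the pointwise stabilizer of \<open>{1..n}\<close> lies in the group of definition and has a finite number
\<open>fix_count X n\<close> of fixed points in \<open>X\<close>. For \<open>\<Omega>\<^sup>(\<^sup>k\<^sup>)\<close> this number is \<open>n choose k\<close>.

The counts respect every relation of \<open>\<Theta>\<close>. For conjugates and for fibres this rests on
\<open>subgroup_moves\<close>: a subgroup that contains the pointwise stabilizers of two finite sets of the
same size contains an element that carries one set to the other. So a hat-set has the same number
of points fixed by the stabilizer of \<open>A\<close> for all finite \<open>A\<close> of a given size whose stabilizer lies
in the group of definition. In particular, for a map of transitive sets, all the fibres over fixed
points have equally many fixed points, which gives the product formula. Counting is therefore a
ring homomorphism from \<open>\<Theta>\<close> to germs at infinity of integer sequences (\<open>eventually_point_count_ideal\<close>).

On the other side, the classes of the \<open>\<Omega>\<^sup>(\<^sup>k\<^sup>)\<close> span \<open>\<Theta>\<close> additively (\<open>spanned_carrier\<close>):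

\<^item> A point \<open>x\<close> of a transitive set \<open>X\<close> has a smallest support \<open>B\<close>, and the stabilizer of \<open>x\<close> maps
  \<open>B\<close> to itself. Hence \<open>g x \<mapsto> g B\<close> is a map from \<open>X\<close> onto an orbit of finite sets. Its fibres are
  finite, so the class of \<open>X\<close> is an integer multiple of the class of that orbit.
\<^item> A family of \<open>n\<close>-sets that is stable under the pointwise stabilizer of \<open>A\<close> falls into orbits
  according to the trace on \<open>A\<close>, and the sets with trace \<open>T\<close> are a copy of the \<open>n - |T|\<close>-sets
  avoiding \<open>A\<close>. Applied to \<open>\<Omega>\<^sup>(\<^sup>n\<^sup>)\<close> this expresses, by induction on \<open>n\<close>, the class of the
  \<open>n\<close>-sets avoiding \<open>A\<close> through classes of \<open>\<Omega>\<^sup>(\<^sup>k\<^sup>)\<close>.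
\<^item> The \<open>j\<close>-sets that avoid a fixed \<open>n\<close>-set \<open>B\<close> form the fibre over \<open>B\<close> of the projection from
  disjoint pairs \<open>(A, B)\<close> to \<open>\<Omega>\<^sup>(\<^sup>n\<^sup>)\<close>. So their class times that of \<open>\<Omega>\<^sup>(\<^sup>n\<^sup>)\<close> is the class of a
  transitive set, and the span is closed under products.

Consequently the count of any element of \<open>\<Theta>\<close> is eventually an integer combination of binomial
polynomials. Such combinations are exactly the integer-valued polynomials, and no nontrivial one
vanishes eventually. So counting is injective on \<open>\<Theta>\<close> with image \<open>\<int>\<langle>x\<rangle>\<close>.\<close>

section \<open>Permutations of Omega\<close>

interpretation Sym: group Sym by (rule Sym_group)

abbreviation Sym_comp (infixl "\<star>" 70) where "g \<star> h \<equiv> g \<otimes>\<^bsub>Sym\<^esub> h"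
abbreviation Sym_inv where "Sym_inv g \<equiv> inv\<^bsub>Sym\<^esub> g"

lemma Sym_inv_apply:
  assumes "g \<in> carrier Sym" "a \<in> Omega"
  shows "Sym_inv g (g a) = a" "g (Sym_inv g a) = a"
  using Sym_mult[of "Sym_inv g" g a] Sym_mult[of g "Sym_inv g" a] assms
  by (simp_all add: Sym_one)

lemma Sym_inj_on: "g \<in> carrier Sym \<Longrightarrow> A \<subseteq> Omega \<Longrightarrow> inj_on g A"
  by (metis Sym_inv_apply(1) inj_on_def subset_iff)

lemma Sym_image_comp:
  assumes "g \<in> carrier Sym" "h \<in> carrier Sym" "A \<subseteq> Omega"
  shows "(g \<star> h) ` A = g ` h ` A"
  using assms by (auto simp: Sym_mult subset_iff image_iff)

lemma Sym_image_one: "A \<subseteq> Omega \<Longrightarrow> \<one>\<^bsub>Sym\<^esub> ` A = A"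
  by (auto simp: Sym_one subset_iff image_iff)

lemma Sym_image_inv:
  assumes "g \<in> carrier Sym" "A \<subseteq> Omega"
  shows "Sym_inv g ` g ` A = A" "g ` Sym_inv g ` A = A"
  using assms by (simp_all flip: Sym_image_comp add: Sym_image_one)

lemma Sym_image_subset: "g \<in> carrier Sym \<Longrightarrow> A \<subseteq> Omega \<Longrightarrow> g ` A \<subseteq> Omega"
  by (auto simp: Sym_closed)

lemma Sym_image_nsets: "g \<in> carrier Sym \<Longrightarrow> A \<in> nsets Omega n \<Longrightarrow> g ` A \<in> nsets Omega n"
  by (auto simp: nsets_def card_image Sym_inj_on Sym_closed)

lemma pointwise_stab_mono: "A \<subseteq> B \<Longrightarrow> pointwise_stab B \<subseteq> pointwise_stab A"
  by (auto simp: pointwise_stab_def)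

lemma pointwise_stab_subset: "pointwise_stab A \<subseteq> carrier Sym"
  by (auto simp: pointwise_stab_def)

lemma subgroup_pointwise_stab: 
  assumes "A \<subseteq> Omega"
  shows "subgroup (pointwise_stab A) Sym"
proof (rule Sym.subgroupI)
  show "pointwise_stab A \<noteq> {}"
    using assms by (auto simp: pointwise_stab_def Sym_one intro!: exI[of _ "\<one>\<^bsub>Sym\<^esub>"])
  show "Sym_inv g \<in> pointwise_stab A" if "g \<in> pointwise_stab A" for g
    using that assms by (auto simp: pointwise_stab_def) (metis Sym_inv_apply(1) subset_iff)
  show "g \<star> h \<in> pointwise_stab A" if "g \<in> pointwise_stab A" "h \<in> pointwise_stab A" for g h
    using that assms by (auto simp: pointwise_stab_def Sym_mult subset_iff)
qed (rule pointwise_stab_subset)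

lemma open_pointwise_stab: "finite A \<Longrightarrow> A \<subseteq> Omega \<Longrightarrow> open_subgroup (pointwise_stab A)"
  by (auto simp: open_subgroup_iff subgroup_pointwise_stab)

lemma pointwise_stab_conj:
  assumes g: "g \<in> carrier Sym" and A: "A \<subseteq> Omega"
  shows "h \<in> pointwise_stab A \<Longrightarrow> g \<star> h \<star> Sym_inv g \<in> pointwise_stab (g ` A)"
    and "h \<in> pointwise_stab (g ` A) \<Longrightarrow> Sym_inv g \<star> h \<star> g \<in> pointwise_stab A"
  using assms by (auto simp: pointwise_stab_def Sym_mult Sym_closed Sym_inv_apply subset_iff)

lemma pointwise_stab_image_le:
  assumes W: "subgroup W Sym" "pointwise_stab A \<subseteq> W" and g: "g \<in> W" and A: "A \<subseteq> Omega"
  shows "pointwise_stab (g ` A) \<subseteq> W"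
proof
  fix h assume h: "h \<in> pointwise_stab (g ` A)"
  interpret W: subgroup W Sym by (rule W)
  have "Sym_inv g \<star> h \<star> g \<in> W" using pointwise_stab_conj(2)[OF _ A h] g W by auto
  then have "g \<star> (Sym_inv g \<star> h \<star> g) \<star> Sym_inv g \<in> W" using g by simp
  then show "h \<in> W" using conj_simps(2)[of g h] g h by (auto simp: pointwise_stab_def)
qed

lemma fresh_point: "finite A \<Longrightarrow> \<exists>e\<in>Omega. e \<notin> A"
  unfolding Omega_def by (meson finite_subset infinite_Ici subsetI)

text \<open>Permutations are extensional functions, hence the restriction of the transposition to \<open>Omega\<close>.\<close>

definition swap :: "nat \<Rightarrow> nat \<Rightarrow> perm" where
  "swap a b = restrict (transpose a b) Omega"

lemma swap_closed:
  assumes "a \<in> Omega" "b \<in> Omega"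
  shows "swap a b \<in> carrier Sym"
proof -
  have "transpose a b x \<in> Omega" if "x \<in> Omega" for x
    using assms that by (simp add: transpose_def)
  then have "bij_betw (transpose a b) Omega Omega"
    by (intro bij_betwI[of _ _ _ "transpose a b"]) auto
  then show ?thesis
    by (simp add: swap_def Sym_def BijGroup_def Bij_def)
qed

lemma swap_apply: "x \<in> Omega \<Longrightarrow> swap a b x = transpose a b x"
  by (simp add: swap_def)

lemma Sym_eqI:
  assumes "g \<in> carrier Sym" "h \<in> carrier Sym" "\<And>a. a \<in> Omega \<Longrightarrow> g a = h a"
  shows "g = h"
  using assms by (auto simp: Sym_def BijGroup_def Bij_def intro: extensionalityI)

lemma swap_in_pointwise_stab:
  "a \<in> Omega - A \<Longrightarrow> b \<in> Omega - A \<Longrightarrow> A \<subseteq> Omega \<Longrightarrow> swap a b \<in> pointwise_stab A"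
  by (auto simp: pointwise_stab_def swap_closed) (auto simp: swap_def transpose_def)

text \<open>The subgroup contains every transposition of two points outside \<open>A \<inter> B\<close>: if one of them is outside
\<open>A\<close> and the other outside \<open>B\<close>, conjugate by a transposition with a point \<open>e\<close> outside both sets.
Composing with such transpositions turns any permutation that fixes \<open>A \<inter> B\<close> into one that
fixes one more point of \<open>A\<close>, and finally into one that fixes all of \<open>A\<close>.\<close>

lemma pointwise_stab_Int_le:
  assumes W: "subgroup W Sym"
    and A: "finite A" "A \<subseteq> Omega" "pointwise_stab A \<subseteq> W"
    and B: "finite B" "B \<subseteq> Omega" "pointwise_stab B \<subseteq> W"
  shows "pointwise_stab (A \<inter> B) \<subseteq> W"
proof
  interpret W: subgroup W Sym by (rule W)
  have cross: "swap a b \<in> W" if a: "a \<in> Omega - A" and b: "b \<in> Omega - B" for a b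
  proof -
    obtain e where e: "e \<in> Omega" "e \<notin> A \<union> B \<union> {a, b}"
      using fresh_point[of "A \<union> B \<union> {a, b}"] A B by auto
    \<comment> \<open>The first one fixes \<open>A\<close> pointwise and the second one fixes \<open>B\<close> pointwise.\<close>
    have in_W: "swap a e \<in> W" "swap b e \<in> W"
      using swap_in_pointwise_stab[of a A e] swap_in_pointwise_stab[of b B e] a b e A B by auto
    show ?thesis
    proof (cases "a = b")
      case True
      then show ?thesis using in_W(1) swap_in_pointwise_stab[of a A b] a A by auto
    next
      case False
      have "swap a b = swap a e \<star> swap b e \<star> swap a e"
      proof (rule Sym_eqI)
        show "swap a b x = (swap a e \<star> swap b e \<star> swap a e) x" if x: "x \<in> Omega" for x
        proof -
          have "swap a e x \<in> Omega" "swap b e (swap a e x) \<in> Omega"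
            using a b e x by (auto simp: swap_closed Sym_closed)
          then have "(swap a e \<star> swap b e \<star> swap a e) x =
              transpose a e (transpose b e (transpose a e x))"
            using a b e x by (simp add: Sym_mult swap_closed) (simp add: swap_apply)
          also have "\<dots> = transpose a b x"
            using False e by (simp add: transpose_def)
          finally show ?thesis using x by (simp add: swap_apply)
        qed
      qed (use a b e in \<open>simp_all add: swap_closed\<close>)
      then show ?thesis using in_W by simp
    qed
  qed
  have swap_W: "swap a b \<in> W" if "a \<in> Omega - A \<inter> B" "b \<in> Omega - A \<inter> B" for a b
  proof -
    have "swap b a = swap a b" by (simp add: swap_def transpose_commute)
    moreover have "swap a b \<in> W" if "a \<notin> A" "b \<notin> A" "a \<in> Omega" "b \<in> Omega" for a b
      using swap_in_pointwise_stab[of a A b] A that by blast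
    moreover have "swap a b \<in> W" if "a \<notin> B" "b \<notin> B" "a \<in> Omega" "b \<in> Omega" for a b
      using swap_in_pointwise_stab[of a B b] B that by blast
    ultimately show ?thesis using cross[of a b] cross[of b a] that by auto
  qed
  fix g assume "g \<in> pointwise_stab (A \<inter> B)"
  then show "g \<in> W"
  proof (induction "card {a \<in> A. g a \<noteq> a}" arbitrary: g rule: less_induct)
    case less
    have g: "g \<in> carrier Sym" and fixed: "\<And>a. a \<in> A \<inter> B \<Longrightarrow> g a = a"
      using less.prems by (auto simp: pointwise_stab_def)
    show ?case
    proof (cases "\<forall>a\<in>A. g a = a")
      case True
      then show ?thesis using A g by (auto simp: pointwise_stab_def)
    next
      case False
      then obtain a where a: "a \<in> A" "g a \<noteq> a" by blast
      then have aO: "a \<in> Omega" using A by auto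
      have gaO: "g a \<in> Omega" using aO g by (simp add: Sym_closed)
      have inj: "g x = g y \<Longrightarrow> x = y" if "x \<in> Omega" "y \<in> Omega" for x y
        using Sym_inv_apply(1)[OF g] that by metis
      have notin: "a \<notin> A \<inter> B" "g a \<notin> A \<inter> B"
        using fixed a inj[OF _ aO] gaO by auto
      have s: "swap a (g a) \<in> W" by (rule swap_W) (use notin aO gaO in auto)
      define h where "h = swap a (g a) \<star> g"
      have h: "h c = transpose a (g a) (g c)" if "c \<in> Omega" for c
        using that Sym_mult[OF swap_closed[OF aO gaO] g that]
        by (simp add: h_def swap_apply Sym_closed[OF g])
      have "h c = c" if "c \<in> A" "g c = c" for c
      proof -
        have c: "c \<in> Omega" using that A by auto
        have "c \<noteq> a" "c \<noteq> g a" using that a inj[OF c aO] by auto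
        then show ?thesis using that h[OF c] by (simp add: transpose_def)
      qed
      moreover have "h a = a" using h[OF aO] by simp
      ultimately have "{c \<in> A. h c \<noteq> c} \<subseteq> {c \<in> A. g c \<noteq> c} - {a}" by blast
      moreover have "a \<in> {c \<in> A. g c \<noteq> c}" using a by simp
      ultimately have "{c \<in> A. h c \<noteq> c} \<subset> {c \<in> A. g c \<noteq> c}" by blast
      then have "card {c \<in> A. h c \<noteq> c} < card {c \<in> A. g c \<noteq> c}"
        using A(1) by (intro psubset_card_mono) auto
      moreover have "h c = c" if "c \<in> A \<inter> B" for c
        using that fixed[OF that] notin h[of c] A(2) by (auto simp: transpose_def)
      then have "h \<in> pointwise_stab (A \<inter> B)"
        using g aO gaO by (simp add: pointwise_stab_def h_def swap_closed)
      ultimately have "h \<in> W" by (rule less.hyps)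
      then have "Sym_inv (swap a (g a)) \<star> h \<in> W" using s by simp
      then show ?thesis using g aO gaO by (simp add: h_def Sym_cancel swap_closed)
    qed
  qed
qed

text \<open>Exchange the points of \<open>B - C\<close> and those of \<open>C - B\<close> one pair at a time; none of these points lies in
\<open>A\<close>.\<close>

lemma pointwise_stab_moves:
  assumes A: "A \<subseteq> Omega" and B: "finite B" "B \<subseteq> Omega" and C: "finite C" "C \<subseteq> Omega"
    and eq: "card B = card C" "B \<inter> A = C \<inter> A"
  shows "\<exists>g\<in>pointwise_stab A. g ` B = C"
  using B eq
proof (induction "card (B - C)" arbitrary: B)
  case 0
  then have "B \<subseteq> C" by simp
  then have "B = C" using 0 C by (simp add: card_subset_eq)
  then show ?case
    using C subgroup.one_closed[OF subgroup_pointwise_stab[OF A]] Sym_image_one by blast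
next
  case (Suc k)
  have ne: "B - C \<noteq> {}" using Suc(2) by (metis card.empty nat.distinct(1))
  then obtain b where b: "b \<in> B" "b \<notin> C" by blast
  have "\<not> C \<subseteq> B" using Suc.prems C b by (metis card_subset_eq)
  then obtain c where c: "c \<in> C" "c \<notin> B" by blast
  have bc: "b \<in> Omega - A" "c \<in> Omega - A" using b c Suc.prems C by auto
  let ?s = "swap b c" and ?B = "insert c (B - {b})"
  have s: "?s \<in> pointwise_stab A" by (rule swap_in_pointwise_stab[OF bc A])
  have sB: "?s ` B = ?B"
    using b c bc Suc.prems(2) by (auto simp: swap_def transpose_def image_iff subset_iff)
  have "B - C = insert b (?B - C)" using b c by auto
  then have "k = card (?B - C)"
    using Suc(2) Suc.prems(1) b c by (auto simp: card_insert_if)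
  moreover have "card ?B = card C"
    using Suc.prems b c by (simp add: card_insert_if) (metis One_nat_def Suc_pred card_gt_0_iff empty_iff)
  ultimately obtain g where g: "g \<in> pointwise_stab A" "g ` ?B = C"
    using Suc.hyps(1)[of ?B] Suc.prems bc by auto
  have "(g \<star> ?s) ` B = C"
    using g(2) sB Suc.prems(2) Sym_image_comp[of g ?s B] g(1) s
    by (simp add: pointwise_stab_def del: image_insert)
  moreover have "g \<star> ?s \<in> pointwise_stab A"
    using g s subgroup.m_closed[OF subgroup_pointwise_stab[OF A]] by blast
  ultimately show ?case by blast
qed

text \<open>The sets \<open>A\<close> and \<open>B\<close> have the same trace on \<open>A \<inter> B\<close>, whose pointwise stabilizer lies in \<open>W\<close>.\<close>

lemma subgroup_moves:
  assumes W: "subgroup W Sym"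
    and A: "finite A" "A \<subseteq> Omega" "pointwise_stab A \<subseteq> W"
    and B: "finite B" "B \<subseteq> Omega" "pointwise_stab B \<subseteq> W"
    and card: "card A = card B"
  shows "\<exists>w\<in>W. w ` A = B"
proof -
  have "\<exists>w\<in>pointwise_stab (A \<inter> B). w ` A = B"
    by (rule pointwise_stab_moves) (use A B card in auto)
  then show ?thesis using pointwise_stab_Int_le[OF W A B] by blast
qed

section \<open>Translates of a point\<close>

context
  fixes X :: "'x hset"
  assumes X: "hat_set X"
begin

lemmas defgrp_subgroup = hat_setD(2)[OF X]

lemma defgrp_carrier: "g \<in> defgrp X \<Longrightarrow> g \<in> carrier Sym"
  using subgroup.subset[OF defgrp_subgroup] by blast

lemmas act_closed = group_action_subgrpD(2)[OF hat_setD(3)[OF X]]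
  and act_one = group_action_subgrpD(3)[OF hat_setD(3)[OF X]]
  and act_comp = group_action_subgrpD(4)[OF hat_setD(3)[OF X]]

lemma act_inv:
  assumes "g \<in> defgrp X" "x \<in> points X"
  shows "act X (Sym_inv g) (act X g x) = x" "act X g (act X (Sym_inv g) x) = x"
  using assms act_comp[of "Sym_inv g" g x] act_comp[of g "Sym_inv g" x] act_one[of x]
    subgroup.m_inv_closed[OF defgrp_subgroup] defgrp_carrier by auto

lemma act_inj: "g \<in> defgrp X \<Longrightarrow> inj_on (act X g) (points X)"
  using act_inv(1) by (metis inj_onI)

lemma stab_subgroup:
  "x \<in> points X \<Longrightarrow> subgroup {g \<in> defgrp X. act X g x = x} Sym"
  using hat_setD(4)[OF X] by (simp add: open_subgroup_def)

lemma act_eqI: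
  assumes x: "x \<in> points X" and B: "B \<subseteq> Omega" "pointwise_stab B \<subseteq> {g \<in> defgrp X. act X g x = x}"
    and uv: "u \<in> defgrp X" "v \<in> defgrp X" "\<And>b. b \<in> B \<Longrightarrow> u b = v b"
  shows "act X u x = act X v x"
proof -
  have c: "u \<in> carrier Sym" "v \<in> carrier Sym" using uv defgrp_carrier by auto
  have "(Sym_inv u \<star> v) b = b" if "b \<in> B" for b
  proof -
    have b: "b \<in> Omega" using that B by auto
    have "(Sym_inv u \<star> v) b = Sym_inv u (u b)"
      using that b c uv(3)[OF that] by (simp add: Sym_mult)
    then show ?thesis using b c by (simp add: Sym_inv_apply)
  qed
  then have k: "Sym_inv u \<star> v \<in> {g \<in> defgrp X. act X g x = x}"
    using B(2) c subsetD[OF B(2), of "Sym_inv u \<star> v"] by (simp add: pointwise_stab_def)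
  have "v = u \<star> (Sym_inv u \<star> v)" using c by (simp add: Sym_cancel)
  then have "act X v x = act X u (act X (Sym_inv u \<star> v) x)"
    using k act_comp[OF uv(1) _ x, of "Sym_inv u \<star> v"] by simp
  then show ?thesis using k by simp
qed

text \<open>A translate of \<open>x\<close> is determined by the restriction of the translating permutation to a support \<open>B\<close>
of \<open>x\<close>, and there are finitely many maps from \<open>B\<close> to \<open>C\<close>.\<close>

lemma finite_translates:
  assumes x: "x \<in> points X" and B: "finite B" "B \<subseteq> Omega"
      "pointwise_stab B \<subseteq> {g \<in> defgrp X. act X g x = x}"
    and C: "finite C"
  shows "finite ((\<lambda>u. act X u x) ` {u \<in> defgrp X. u ` B \<subseteq> C})" (is "finite (?F ` ?P)")
proof -
  let ?r = "\<lambda>u. restrict u B"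
  have "?r ` ?P \<subseteq> B \<rightarrow>\<^sub>E C" by auto
  then have fin: "finite (?r ` ?P)" using B C by (meson finite_PiE finite_subset)
  have "?F u = ?F (inv_into ?P ?r (?r u))" if u: "u \<in> ?P" for u
  proof -
    have v: "inv_into ?P ?r (?r u) \<in> ?P" "?r (inv_into ?P ?r (?r u)) = ?r u"
      using inv_into_into[OF imageI[OF u]] f_inv_into_f[OF imageI[OF u, of ?r]] by blast+
    show ?thesis
    proof (rule act_eqI[OF x B(2,3)])
      show "u b = inv_into ?P ?r (?r u) b" if "b \<in> B" for b
        using fun_cong[OF v(2), of b] that by simp
    qed (use u v in auto)
  qed
  then have "?F ` ?P \<subseteq> (\<lambda>t. ?F (inv_into ?P ?r t)) ` ?r ` ?P" by blast
  then show ?thesis using fin by (meson finite_imageI finite_subset)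
qed

end

section \<open>Counting fixed points\<close>

text \<open>The action is meaningful on the group of definition alone. For \<open>A = {1..n}\<close> with \<open>n\<close> large, that
group contains the whole pointwise stabilizer, so the intersection does not affect the count.\<close>

definition fixed_points :: "'x hset \<Rightarrow> nat set \<Rightarrow> 'x set" where
  "fixed_points X A = {x \<in> points X. \<forall>g\<in>pointwise_stab A \<inter> defgrp X. act X g x = x}"

definition fix_count :: "'x hset \<Rightarrow> nat \<Rightarrow> nat" where
  "fix_count X n = card (fixed_points X {1..n})"

lemma fixed_points_iff:
  "pointwise_stab A \<subseteq> defgrp X \<Longrightarrow>
   x \<in> fixed_points X A \<longleftrightarrow> x \<in> points X \<and> pointwise_stab A \<subseteq> {g \<in> defgrp X. act X g x = x}"
  by (auto simp: fixed_points_def)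

lemma fixed_points_image:
  assumes X: "hat_set X" and u: "u \<in> defgrp X" and A: "A \<subseteq> Omega"
  shows "fixed_points X (u ` A) = act X u ` fixed_points X A"
proof -
  have sub: "act X g ` fixed_points X B \<subseteq> fixed_points X (g ` B)"
    if g: "g \<in> defgrp X" and B: "B \<subseteq> Omega" for g B
  proof (safe)
    fix x assume "x \<in> fixed_points X B"
    then have x: "x \<in> points X" "\<And>h. h \<in> pointwise_stab B \<Longrightarrow> h \<in> defgrp X \<Longrightarrow> act X h x = x"
      by (auto simp: fixed_points_def)
    interpret U: subgroup "defgrp X" Sym by (rule defgrp_subgroup[OF X])
    have gc: "g \<in> carrier Sym" using g by simp
    have "act X h (act X g x) = act X g x" if h: "h \<in> pointwise_stab (g ` B)" "h \<in> defgrp X" for h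
    proof -
      let ?k = "Sym_inv g \<star> h \<star> g"
      have k: "?k \<in> defgrp X" using g h by simp
      then have "act X ?k x = x" using x(2) pointwise_stab_conj(2)[OF gc B h(1)] by blast
      moreover have "g \<star> ?k = h \<star> g" using g h by (simp add: Sym.m_assoc Sym_cancel)
      ultimately show ?thesis
        using act_comp[OF X g k x(1)] act_comp[OF X h(2) g x(1)] by simp
    qed
    then show "act X g x \<in> fixed_points X (g ` B)"
      using act_closed[OF X g x(1)] by (simp add: fixed_points_def)
  qed
  have c: "u \<in> carrier Sym" using u defgrp_carrier[OF X] by blast
  have ui: "Sym_inv u \<in> defgrp X" using u defgrp_subgroup[OF X] by (simp add: subgroup.m_inv_closed)
  have "act X (Sym_inv u) ` fixed_points X (u ` A) \<subseteq> fixed_points X A"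
    using sub[OF ui Sym_image_subset[OF c A]] Sym_image_inv[OF c A] by simp
  then have "act X u ` act X (Sym_inv u) ` fixed_points X (u ` A) \<subseteq> act X u ` fixed_points X A"
    by blast
  moreover have "act X u ` act X (Sym_inv u) ` fixed_points X (u ` A) = fixed_points X (u ` A)"
    using act_inv(2)[OF X u] by (force simp: fixed_points_def image_iff)
  ultimately show ?thesis using sub[OF u A] by blast
qed

text \<open>This is what makes \<open>{1..n}\<close> in \<open>fix_count\<close> a harmless choice among the sets of size \<open>n\<close>.\<close>

lemma card_fixed_points_cong:
  assumes X: "hat_set X"
    and A: "finite A" "A \<subseteq> Omega" "pointwise_stab A \<subseteq> defgrp X"
    and B: "finite B" "B \<subseteq> Omega" "pointwise_stab B \<subseteq> defgrp X"
    and card: "card A = card B"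
  shows "card (fixed_points X A) = card (fixed_points X B)"
proof -
  obtain w where w: "w \<in> defgrp X" "w ` A = B"
    using subgroup_moves[OF defgrp_subgroup[OF X] A B card] by blast
  have "inj_on (act X w) (fixed_points X A)"
    by (rule inj_on_subset[OF act_inj[OF X w(1)]]) (auto simp: fixed_points_def)
  then show ?thesis
    using fixed_points_image[OF X w(1) A(2)] w(2) by (simp add: card_image)
qed

lemma eventually_pointwise_stab_le:
  assumes "open_subgroup U"
  shows "\<forall>\<^sub>F n in sequentially. pointwise_stab {1..n} \<subseteq> U"
proof -
  obtain A where A: "finite A" "A \<subseteq> Omega" "pointwise_stab A \<subseteq> U"
    using assms by (auto simp: open_subgroup_iff)
  obtain N where "A \<subseteq> {..<N}" using A(1) finite_nat_bounded by blast
  then have "A \<subseteq> {1..n}" if "n \<ge> N" for n using A(2) that by (force simp: Omega_def)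
  then show ?thesis
    using A(3) pointwise_stab_mono unfolding eventually_sequentially by blast
qed

lemma Icc_Omega: "{1..n} \<subseteq> Omega"
  by (auto simp: Omega_def)

lemma points_eq_Union_orbits:
  assumes X: "hat_set X"
  shows "points X = \<Union>(orbits (subgrp (defgrp X)) (points X) (act X))"
proof -
  have one: "\<one>\<^bsub>Sym\<^esub> \<in> defgrp X" by (rule subgroup.one_closed[OF defgrp_subgroup[OF X]])
  have "x \<in> orbit (subgrp (defgrp X)) (act X) x" if "x \<in> points X" for x
    unfolding orbit_def using act_one[OF X that] one by (simp, metis)
  then show ?thesis using act_closed[OF X] by (auto simp: orbits_def orbit_def)
qed

text \<open>It suffices to treat one orbit. If \<open>u x\<close> is fixed by the stabilizer of \<open>{1..n}\<close>, then \<open>x\<close> is supported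
by the preimage of \<open>{1..n}\<close> under \<open>u\<close>. The stabilizer of \<open>x\<close> moves a fixed support of size \<open>n\<close> to that
preimage, so \<open>u\<close> may be chosen to map the fixed support to \<open>{1..n}\<close>; finitely many translates remain.\<close>

lemma eventually_finite_fixed_points:
  assumes "finitary X"
  shows "\<forall>\<^sub>F n in sequentially. finite (fixed_points X {1..n})"
proof -
  let ?orb = "orbit (subgrp (defgrp X)) (act X)"
  have X: "hat_set X" and fin: "finite (orbits (subgrp (defgrp X)) (points X) (act X))"
    using assms by (auto simp: finitary_def)
  interpret U: subgroup "defgrp X" Sym by (rule defgrp_subgroup[OF X])
  have "\<forall>\<^sub>F n in sequentially. finite (fixed_points X {1..n} \<inter> ?orb x)" if x: "x \<in> points X" for x
  proof -
    let ?W = "{g \<in> defgrp X. act X g x = x}"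
    obtain B where B: "finite B" "B \<subseteq> Omega" "pointwise_stab B \<subseteq> ?W"
      using hat_setD(4)[OF X x] by (auto simp: open_subgroup_iff)
    have "finite (fixed_points X {1..n} \<inter> ?orb x)"
      if n: "n \<ge> card B" "pointwise_stab {1..n} \<subseteq> defgrp X" for n
    proof -
      have "infinite (Omega - B)" using B by (simp add: Omega_def infinite_Ici)
      then obtain D where D: "finite D" "card D = n - card B" "D \<subseteq> Omega - B"
        using infinite_arbitrarily_large by blast
      \<comment> \<open>A support of \<open>x\<close> of size exactly \<open>n\<close>.\<close>
      let ?B = "B \<union> D"
      have B': "finite ?B" "?B \<subseteq> Omega" "pointwise_stab ?B \<subseteq> ?W" "card ?B = n"
        using B D n(1) pointwise_stab_mono[of B "B \<union> D"]
          card_Un_disjoint[of B D]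
        by auto
      have "fixed_points X {1..n} \<inter> ?orb x \<subseteq>
          (\<lambda>u. act X u x) ` {u \<in> defgrp X. u ` ?B \<subseteq> {1..n}}"
      proof
        fix y assume y: "y \<in> fixed_points X {1..n} \<inter> ?orb x"
        then obtain u where u: "u \<in> defgrp X" "y = act X u x" by (auto simp: orbit_def)
        have uc: "u \<in> carrier Sym" using u by simp
        let ?C = "Sym_inv u ` {1..n}"
        have C: "finite ?C" "?C \<subseteq> Omega" "card ?C = n"
          using uc Sym_image_subset[of "Sym_inv u" "{1..n}"] Icc_Omega
          by (simp_all add: card_image Sym_inj_on)
        have "x \<in> fixed_points X ?C"
        proof -
          have "act X (Sym_inv u) y \<in> fixed_points X ?C"
            using fixed_points_image[OF X _ Icc_Omega, of "Sym_inv u"] u(1) y by blast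
          then show ?thesis using act_inv(1)[OF X u(1) x] u(2) by simp
        qed
        moreover have "pointwise_stab ?C \<subseteq> defgrp X"
          by (rule pointwise_stab_image_le[OF U.subgroup_axioms n(2)]) (use u Icc_Omega in auto)
        ultimately have "pointwise_stab ?C \<subseteq> ?W" by (simp add: fixed_points_iff)
        then obtain w where w: "w \<in> ?W" "w ` ?B = ?C"
          using subgroup_moves[OF stab_subgroup[OF X x] B'(1-3) C(1,2)] B'(4) C(3) by auto
        have "(u \<star> w) ` ?B = {1..n}"
          using Sym_image_comp[OF uc _ B'(2)] w Sym_image_inv(2)[OF uc Icc_Omega] U.subset by auto
        moreover have "u \<star> w \<in> defgrp X" "act X (u \<star> w) x = y"
          using u w act_comp[OF X u(1) _ x, of w] by auto
        ultimately show "y \<in> (\<lambda>u. act X u x) ` {u \<in> defgrp X. u ` ?B \<subseteq> {1..n}}"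
          by (intro image_eqI[of _ _ "u \<star> w"]) auto
      qed
      moreover have "finite ((\<lambda>u. act X u x) ` {u \<in> defgrp X. u ` ?B \<subseteq> {1..n}})"
        by (rule finite_translates[OF X x B'(1-3)]) simp
      ultimately show ?thesis by (rule finite_subset)
    qed
    note * = this
    show ?thesis
      using eventually_pointwise_stab_le[OF hat_setD(1)[OF X]] eventually_ge_at_top[of "card B"]
      by eventually_elim (rule *)
  qed
  then have "\<forall>S\<in>orbits (subgrp (defgrp X)) (points X) (act X).
      \<forall>\<^sub>F n in sequentially. finite (fixed_points X {1..n} \<inter> S)"
    by (auto simp: orbits_def)
  then have "\<forall>\<^sub>F n in sequentially. \<forall>S\<in>orbits (subgrp (defgrp X)) (points X) (act X).
      finite (fixed_points X {1..n} \<inter> S)"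
    by (simp add: eventually_ball_finite_distrib[OF fin])
  then show ?thesis
  proof (rule eventually_mono)
    fix n assume *: "\<forall>S\<in>orbits (subgrp (defgrp X)) (points X) (act X). finite (fixed_points X {1..n} \<inter> S)"
    have "fixed_points X {1..n} =
        (\<Union>S\<in>orbits (subgrp (defgrp X)) (points X) (act X). fixed_points X {1..n} \<inter> S)"
      using points_eq_Union_orbits[OF X] by (auto simp: fixed_points_def)
    moreover have "finite \<dots>" using * fin by blast
    ultimately show "finite (fixed_points X {1..n})" by simp
  qed
qed

section \<open>Invariance of the counts under the relations\<close>

lemma eventually_fix_count_iso:
  assumes X: "hat_set X" and iso: "hat_iso X Y"
  shows "\<forall>\<^sub>F n in sequentially. fix_count X n = fix_count Y n"
proof -
  obtain f W where f: "bij_betw f (points X) (points Y)" and W: "open_subgroup W"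
      "W \<subseteq> defgrp X" "W \<subseteq> defgrp Y" and eqv: "\<forall>g\<in>W. \<forall>x\<in>points X. f (act X g x) = act Y g (f x)"
    using iso by (auto simp: hat_iso_def hat_map_def)
  show ?thesis
    using eventually_pointwise_stab_le[OF W(1)]
  proof (rule eventually_mono)
    fix n assume n: "pointwise_stab {1..n} \<subseteq> W"
    have fixed: "x \<in> fixed_points X {1..n} \<longleftrightarrow> f x \<in> fixed_points Y {1..n}" if x: "x \<in> points X" for x
    proof -
      have "act X g x = x \<longleftrightarrow> act Y g (f x) = f x" if "g \<in> pointwise_stab {1..n}" for g
      proof -
        have g: "g \<in> W" using that n by blast
        then have "f (act X g x) = act Y g (f x)" using eqv x by blast
        moreover have "act X g x \<in> points X" using g W x by (intro act_closed[OF X]) auto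
        ultimately show ?thesis using f x by (metis bij_betw_imp_inj_on inj_onD)
      qed
      moreover have "f x \<in> points Y" using f x by (auto simp: bij_betw_def)
      moreover have "pointwise_stab {1..n} \<inter> defgrp X = pointwise_stab {1..n}"
        "pointwise_stab {1..n} \<inter> defgrp Y = pointwise_stab {1..n}"
        using n W by auto
      ultimately show ?thesis using x by (auto simp: fixed_points_def)
    qed
    have "f ` fixed_points X {1..n} = fixed_points Y {1..n}"
    proof
      show "fixed_points Y {1..n} \<subseteq> f ` fixed_points X {1..n}"
      proof
        fix y assume y: "y \<in> fixed_points Y {1..n}"
        then have "y \<in> f ` points X" using f by (auto simp: fixed_points_def bij_betw_def)
        then show "y \<in> f ` fixed_points X {1..n}" using fixed y by blast
      qed
    qed (use fixed in \<open>auto simp: fixed_points_def\<close>)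
    moreover have "inj_on f (fixed_points X {1..n})"
      by (rule inj_on_subset[OF bij_betw_imp_inj_on[OF f]]) (auto simp: fixed_points_def)
    ultimately show "fix_count X n = fix_count Y n"
      by (metis fix_count_def card_image)
  qed
qed

lemma fix_count_singleton:
  assumes "hat_set X" "points X = {x}"
  shows "fix_count X n = 1"
proof -
  have "fixed_points X {1..n} = {x}"
    using act_closed[OF assms(1)] assms(2) by (auto simp: fixed_points_def)
  then show ?thesis by (simp add: fix_count_def)
qed

lemma eventually_fix_count_sum:
  assumes "finitary X" "finitary Y"
  shows "\<forall>\<^sub>F n in sequentially. fix_count (hat_sum X Y) n = fix_count X n + fix_count Y n"
proof -
  have "open_subgroup (defgrp X)" "open_subgroup (defgrp Y)"
    using assms by (auto simp: finitary_def intro: hat_setD(1))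
  note ev = eventually_pointwise_stab_le[OF this(1)] eventually_pointwise_stab_le[OF this(2)]
    eventually_finite_fixed_points[OF assms(1)] eventually_finite_fixed_points[OF assms(2)]
  show ?thesis
    using ev
  proof eventually_elim
    case (elim n)
    have "pointwise_stab {1..n} \<inter> (defgrp X \<inter> defgrp Y) = pointwise_stab {1..n}"
      "pointwise_stab {1..n} \<inter> defgrp X = pointwise_stab {1..n}"
      "pointwise_stab {1..n} \<inter> defgrp Y = pointwise_stab {1..n}"
      using elim by auto
    then have "fixed_points (hat_sum X Y) {1..n} =
        Sum_Type.Plus (fixed_points X {1..n}) (fixed_points Y {1..n})"
      by (auto simp: fixed_points_def hat_sum_def)
    then show ?case using elim by (simp add: fix_count_def card_Plus)
  qed
qed

text \<open>Fixed points of the stabilizer of \<open>{1..n}\<close> in the conjugate are the points of \<open>X\<close> fixed by the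
stabilizer of another set of size \<open>n\<close>.\<close>

lemma eventually_fix_count_conj:
  assumes X: "hat_set X" and g: "g \<in> carrier Sym"
  shows "\<forall>\<^sub>F n in sequentially. fix_count (hat_conj X g) n = fix_count X n"
proof -
  note U = hat_setD(1)[OF X]
  interpret U: subgroup "defgrp X" Sym by (rule defgrp_subgroup[OF X])
  note mem = mem_conj_iff[OF U.subset g]
  show ?thesis
    using eventually_pointwise_stab_le[OF U] eventually_pointwise_stab_le[OF open_subgroup_conj[OF U g]]
  proof eventually_elim
    case (elim n)
    let ?C = "Sym_inv g ` {1..n}"
    have C: "finite ?C" "?C \<subseteq> Omega" "card ?C = card {1..n}"
      using g Sym_image_subset[of "Sym_inv g" "{1..n}"] Icc_Omega
      by (simp_all add: card_image Sym_inj_on)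
    have gC: "g ` ?C = {1..n}" using Sym_image_inv(2)[OF g Icc_Omega] .
    have k: "g \<star> k \<star> Sym_inv g \<in> pointwise_stab {1..n}" if "k \<in> pointwise_stab ?C" for k
      using pointwise_stab_conj(1)[OF g C(2) that] gC by simp
    have h: "Sym_inv g \<star> h \<star> g \<in> pointwise_stab ?C" if "h \<in> pointwise_stab {1..n}" for h
      using pointwise_stab_conj(2)[OF g C(2)] gC that by simp
    have kU: "pointwise_stab ?C \<subseteq> defgrp X"
    proof
      fix k assume "k \<in> pointwise_stab ?C"
      then show "k \<in> defgrp X"
        using k elim(2) mem[of "g \<star> k \<star> Sym_inv g"] g conj_simps(1)[of g k] pointwise_stab_subset
        by (metis subset_iff)
    qed
    have "fixed_points (hat_conj X g) {1..n} = fixed_points X ?C"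
    proof (intro Set.set_eqI iffI)
      fix x assume x: "x \<in> fixed_points (hat_conj X g) {1..n}"
      have "act X k x = x" if "k \<in> pointwise_stab ?C" for k
      proof -
        have "act X (Sym_inv g \<star> (g \<star> k \<star> Sym_inv g) \<star> g) x = x"
          using x k[OF that] elim(2) unfolding fixed_points_def hat_conj_def by auto
        then show ?thesis using conj_simps(1)[of g k] g that by (simp add: pointwise_stab_def)
      qed
      then show "x \<in> fixed_points X ?C"
        using x by (simp add: fixed_points_def hat_conj_def)
    next
      fix x assume x: "x \<in> fixed_points X ?C"
      then show "x \<in> fixed_points (hat_conj X g) {1..n}"
        using h kU by (auto simp: fixed_points_def hat_conj_def)
    qed
    then show ?case
      using card_fixed_points_cong[OF X C(1,2) kU _ Icc_Omega elim(1) C(3)]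
      by (simp add: fix_count_def)
  qed
qed

text \<open>Fixed points lie over fixed points. If \<open>z = u y\<close> is fixed, then \<open>u\<close> identifies the fixed points over
\<open>z\<close> with the points over \<open>y\<close> fixed by the stabilizer of the preimage of \<open>{1..n}\<close> under \<open>u\<close>. That
stabilizer lies in the stabilizer of \<open>y\<close>, the group of definition of the fibre, so their number is
\<open>fix_count\<close> of the fibre, for every \<open>z\<close>.\<close>

lemma eventually_fix_count_fiber:
  assumes X: "hat_set X" and Y: "hat_set Y" and grp: "defgrp X = defgrp Y"
    and tr: "hat_transitive X" "hat_transitive Y"
    and f: "f \<in> points X \<rightarrow> points Y"
    and eqv: "\<forall>g\<in>defgrp X. \<forall>x\<in>points X. f (act X g x) = act Y g (f x)"
    and y: "y \<in> points Y"
  shows "\<forall>\<^sub>F n in sequentially. fix_count X n = fix_count (hat_fiber X Y f y) n * fix_count Y n"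
proof -
  let ?F = "hat_fiber X Y f y" and ?S = "{g \<in> defgrp Y. act Y g y = y}"
  have F: "hat_set ?F" using finitary_hat_fiber[OF assms] by (simp add: finitary_def)
  have dF: "defgrp ?F = ?S" by (simp add: hat_fiber_def stabilizer_def)
  have finX: "finitary X" and finY: "finitary Y"
    using X Y tr by (simp_all add: finitary_transitive)
  interpret U: subgroup "defgrp Y" Sym by (rule defgrp_subgroup[OF Y])
  show ?thesis
    using eventually_pointwise_stab_le[OF hat_setD(4)[OF Y y]]
      eventually_finite_fixed_points[OF finX] eventually_finite_fixed_points[OF finY]
  proof eventually_elim
    case (elim n)
    have nY: "pointwise_stab {1..n} \<subseteq> defgrp Y" using elim(1) by blast
    have fib: "card {x \<in> fixed_points X {1..n}. f x = z} = fix_count ?F n"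
      if z: "z \<in> fixed_points Y {1..n}" for z
    proof -
      have "z \<in> points Y" using z by (simp add: fixed_points_def)
      then obtain u where u: "u \<in> defgrp Y" "act Y u y = z"
        using transitive_action.unique_orbit[of "subgrp (defgrp Y)" "points Y" "act Y" y z] tr(2) y
        by (auto simp: hat_transitive_def)
      have uX: "u \<in> defgrp X" using u grp by simp
      have uc: "u \<in> carrier Sym" "Sym_inv u \<in> defgrp Y" "Sym_inv u \<in> defgrp X" using u grp by auto
      let ?C = "Sym_inv u ` {1..n}"
      have C: "finite ?C" "?C \<subseteq> Omega" "card ?C = card {1..n}"
        using uc Sym_image_subset[of "Sym_inv u" "{1..n}"] Icc_Omega
        by (simp_all add: card_image Sym_inj_on)
      have uC: "u ` ?C = {1..n}" using Sym_image_inv(2)[OF uc(1) Icc_Omega] .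
      have "pointwise_stab ?C \<subseteq> defgrp Y"
        by (rule pointwise_stab_image_le[OF U.subgroup_axioms nY uc(2) Icc_Omega])
      moreover have "y \<in> fixed_points Y ?C"
        using fixed_points_image[OF Y uc(2) Icc_Omega] z u(2) act_inv(1)[OF Y u(1) y] by force
      ultimately have CS: "pointwise_stab ?C \<subseteq> ?S" by (simp add: fixed_points_iff)
      have "fixed_points ?F ?C = {x \<in> fixed_points X ?C. f x = y}"
        using CS unfolding fixed_points_def dF by (auto simp: hat_fiber_def grp)
      moreover have "{x \<in> fixed_points X {1..n}. f x = z} =
          act X u ` {x \<in> fixed_points X ?C. f x = y}"
      proof -
        have eq: "f (act X u x) = z \<longleftrightarrow> f x = y" if "x \<in> points X" for x
        proof -
          have "f (act X u x) = act Y u (f x)" "f x \<in> points Y" using eqv uX that f by auto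
          then show ?thesis using u(2) y act_inj[OF Y u(1)] by (auto dest: inj_onD)
        qed
        have "fixed_points X {1..n} = act X u ` fixed_points X ?C"
          using fixed_points_image[OF X uX C(2)] uC by simp
        moreover have "fixed_points X ?C \<subseteq> points X" by (auto simp: fixed_points_def)
        ultimately show ?thesis using eq by (simp add: set_eq_iff image_iff) blast
      qed
      moreover have "inj_on (act X u) {x \<in> fixed_points X ?C. f x = y}"
        by (rule inj_on_subset[OF act_inj[OF X uX]]) (auto simp: fixed_points_def)
      ultimately have "card {x \<in> fixed_points X {1..n}. f x = z} = card (fixed_points ?F ?C)"
        by (simp add: card_image)
      also have "\<dots> = fix_count ?F n"
        unfolding fix_count_def
        by (rule card_fixed_points_cong[OF F C(1,2) _ _ Icc_Omega _ C(3)])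
           (use CS elim(1) dF in auto)
      finally show ?thesis .
    qed
    have "f x \<in> fixed_points Y {1..n}" if x: "x \<in> fixed_points X {1..n}" for x
      using x f eqv grp by (fastforce simp: fixed_points_def)
    then have "fixed_points X {1..n} = (\<Union>z\<in>fixed_points Y {1..n}. {x \<in> fixed_points X {1..n}. f x = z})"
      by blast
    then have "card (fixed_points X {1..n}) =
        (\<Sum>z\<in>fixed_points Y {1..n}. card {x \<in> fixed_points X {1..n}. f x = z})"
      using elim(2,3) card_UN_disjoint[of "fixed_points Y {1..n}" "\<lambda>z. {x \<in> fixed_points X {1..n}. f x = z}"]
      by auto
    also have "\<dots> = (\<Sum>z\<in>fixed_points Y {1..n}. fix_count ?F n)"
      by (intro sum.cong refl fib)
    finally show ?case by (simp add: fix_count_def mult.commute)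
  qed
qed

text \<open>A fixed set is contained in \<open>{1..n}\<close>: otherwise one of its points could be swapped with a point
outside both the set and \<open>{1..n}\<close>.\<close>

lemma fix_count_Omega_sets: "fix_count (Omega_sets k) n = n choose k"
proof -
  have defgrp: "defgrp (Omega_sets k) = carrier Sym" by (simp add: Omega_sets_def)
  have "fixed_points (Omega_sets k) {1..n} = nsets {1..n} k"
  proof (intro Set.set_eqI iffI)
    fix B assume "B \<in> fixed_points (Omega_sets k) {1..n}"
    then have *: "B \<in> points (Omega_sets k)"
        "\<forall>g\<in>pointwise_stab {1..n} \<inter> carrier Sym. act (Omega_sets k) g B = B"
      using defgrp by (simp_all add: fixed_points_def)
    then have B: "B \<in> nsets Omega k" by (simp add: Omega_sets_def)
    then have fixed: "\<forall>g\<in>pointwise_stab {1..n} \<inter> carrier Sym. g ` B = B"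
      using *(2) by (simp add: Omega_sets_def)
    have inv: "g ` B = B" if "g \<in> pointwise_stab {1..n}" for g
      using bspec[OF fixed, of g] that pointwise_stab_subset by blast
    have "b \<in> {1..n}" if b: "b \<in> B" for b
    proof (rule ccontr)
      assume nb: "b \<notin> {1..n}"
      have bO: "b \<in> Omega" using b B by (auto simp: nsets_def)
      obtain e where e: "e \<in> Omega" "e \<notin> B \<union> {1..n}"
        using fresh_point[of "B \<union> {1..n}"] B by (auto simp: nsets_def)
      have "swap b e ` B = B"
        by (intro inv swap_in_pointwise_stab) (use nb bO e Icc_Omega in auto)
      moreover have "swap b e b = e" using bO by (simp add: swap_apply)
      ultimately show False using b e(2) by (metis UnI1 image_eqI)
    qed
    then show "B \<in> nsets {1..n} k" using B by (auto simp: nsets_def)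
  next
    fix B assume B: "B \<in> nsets {1..n} k"
    then have BO: "B \<in> nsets Omega k" using Icc_Omega by (auto simp: nsets_def)
    have "g ` B = B" if "g \<in> pointwise_stab {1..n}" for g
    proof -
      have "g ` B = id ` B"
        using that B by (intro image_cong) (auto simp: pointwise_stab_def nsets_def)
      then show ?thesis by simp
    qed
    then show "B \<in> fixed_points (Omega_sets k) {1..n}"
      using BO by (simp add: fixed_points_def Omega_sets_def)
  qed
  then show ?thesis by (simp add: fix_count_def)
qed

section \<open>The counting homomorphism\<close>

text \<open>The linear extension of \<open>f\<close> to formal integer combinations. It serves for monomials in the free ring,
for the classes of the \<open>\<Omega>\<^sup>(\<^sup>k\<^sup>)\<close>, and for binomial polynomials.\<close>

definition int_comb :: "('k \<Rightarrow> 'b::comm_ring_1) \<Rightarrow> ('k \<Rightarrow>\<^sub>0 int) \<Rightarrow> 'b" where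
  "int_comb f c = (\<Sum>k\<in>Poly_Mapping.keys c. of_int (Poly_Mapping.lookup c k) * f k)"

lemma int_comb_0 [simp]: "int_comb f 0 = 0"
  by (simp add: int_comb_def)

lemma int_comb_of [simp]: "int_comb f (frag_of k) = f k"
  by (simp add: int_comb_def)

lemma int_comb_add: "int_comb f (c + d) = int_comb f c + int_comb f d"
  unfolding int_comb_def by (rule setsum_keys_plus_distrib) (simp_all add: distrib_right)

lemma int_comb_diff: "int_comb f (c - d) = int_comb f c - int_comb f d"
  using int_comb_add[of f "c - d" d] by simp

lemma additive_int_comb:
  assumes "\<phi> 0 = 0" "\<And>x y. \<phi> (x - y) = \<phi> x - \<phi> y"
  shows "\<phi> (int_comb f c) = int_comb (\<lambda>k. \<phi> (f k)) c"
  using subset_UNIV by (induction c rule: frag_induction) (simp_all add: assms int_comb_diff)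

text \<open>For each \<open>n\<close>, the ring homomorphism from the polynomial ring on all hat-sets to the integers that
sends the variable of \<open>X\<close> to \<open>fix_count X n\<close>.\<close>

definition point_count :: "nat \<Rightarrow> ('x hset multiset \<Rightarrow>\<^sub>0 int) \<Rightarrow> int" where
  "point_count n = int_comb (\<lambda>m. \<Prod>X\<in>#m. int (fix_count X n))"

lemma point_count_simps [simp]:
  "point_count n 0 = 0"
  "point_count n (symbol X) = int (fix_count X n)"
  "point_count n (p - q) = point_count n p - point_count n q"
  "point_count n (p + q) = point_count n p + point_count n q"
  by (simp_all add: point_count_def int_comb_diff int_comb_add symbol_def)

lemma point_count_1 [simp]: "point_count n 1 = 1"
  using int_comb_of[of "\<lambda>m. \<Prod>X\<in>#m. int (fix_count X n)" "{#}"]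
  by (simp add: point_count_def)

lemma point_count_mult [simp]: "point_count n (p * q) = point_count n p * point_count n q"
proof -
  have one: "point_count n (frag_of k * q) = point_count n (frag_of k) * point_count n q" for k q
    using subset_UNIV
  proof (induction q rule: frag_induction)
    case (one l)
    have "frag_of k * frag_of l = frag_of (k + l)" by (simp add: mult_single)
    then show ?case by (simp add: point_count_def)
  qed (simp_all add: right_diff_distrib)
  show ?thesis
    using subset_UNIV
    by (induction p rule: frag_induction) (simp_all add: one left_diff_distrib)
qed

interpretation free_ring: cring free_ring
  by (rule cring_free_ring)

lemma free_ring_minus:
  assumes "p \<in> carrier free_ring"
  shows "\<ominus>\<^bsub>free_ring\<^esub> p = - p"
  using free_ring.minus_equality[of "- p" p] assms by simp

abbreviation relation_ideal :: "('x hset multiset \<Rightarrow>\<^sub>0 int) set" where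
  "relation_ideal \<equiv> Idl\<^bsub>free_ring\<^esub> relators"

lemma ideal_relation_ideal: "ideal relation_ideal free_ring"
  by (rule free_ring.genideal_ideal[OF relators_subset])

lemmas additive_relation_ideal = ideal.axioms(1)[OF ideal_relation_ideal]

lemma relators_in_ideal: "r \<in> relators \<Longrightarrow> r \<in> relation_ideal"
  using free_ring.genideal_self[OF relators_subset] by blast

lemma ideal_carrier: "p \<in> relation_ideal \<Longrightarrow> p \<in> carrier free_ring"
  by (rule ideal.Icarr[OF ideal_relation_ideal])

lemma ideal_0: "0 \<in> relation_ideal"
  using additive_subgroup.zero_closed[OF additive_relation_ideal] by simp

lemma ideal_add: "p \<in> relation_ideal \<Longrightarrow> q \<in> relation_ideal \<Longrightarrow> p + q \<in> relation_ideal"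
  using additive_subgroup.a_closed[OF additive_relation_ideal, of p q] by simp

lemma ideal_minus: "p \<in> relation_ideal \<Longrightarrow> - p \<in> relation_ideal"
  using additive_subgroup.a_inv_closed[OF additive_relation_ideal, of p] free_ring_minus[OF ideal_carrier, of p] by simp

lemma ideal_diff: "p \<in> relation_ideal \<Longrightarrow> q \<in> relation_ideal \<Longrightarrow> p - q \<in> relation_ideal"
  using ideal_add[OF _ ideal_minus, of p q] by simp

lemma ideal_mult: "p \<in> relation_ideal \<Longrightarrow> q \<in> carrier free_ring \<Longrightarrow> p * q \<in> relation_ideal"
  using ideal.I_r_closed[OF ideal_relation_ideal, of p q] by (simp del: free_ring_simps(1))

text \<open>Each relation is respected only from some \<open>n\<close> on, and that bound depends on the relation; the elements
whose counts vanish eventually nevertheless form an ideal.\<close>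

lemma eventually_point_count_ideal:
  fixes p :: "'x hset multiset \<Rightarrow>\<^sub>0 int"
  assumes "p \<in> relation_ideal"
  shows "\<forall>\<^sub>F n in sequentially. point_count n p = 0"
proof -
  let ?K = "{p :: 'x hset multiset \<Rightarrow>\<^sub>0 int. p \<in> carrier free_ring \<and> (\<forall>\<^sub>F n in sequentially. point_count n p = 0)}"
  have "ideal ?K free_ring"
  proof (rule idealI)
    show "subgroup ?K (add_monoid free_ring)"
    proof (rule free_ring.add.subgroupI)
      show "?K \<noteq> {}" by (auto intro!: exI[of _ 0])
      show "\<ominus>\<^bsub>free_ring\<^esub> a \<in> ?K" if a: "a \<in> ?K" for a
      proof -
        have "point_count n (- a) = - point_count n a" for n
          using point_count_simps(3)[of n 0 a] by simp
        then show ?thesis using a free_ring_minus[of a] by simp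
      qed
      show "a \<oplus>\<^bsub>free_ring\<^esub> b \<in> ?K" if "a \<in> ?K" "b \<in> ?K" for a b
      proof -
        have "\<forall>\<^sub>F n in sequentially. point_count n (a + b) = 0"
          using that by (auto elim: eventually_elim2)
        then show ?thesis
          using that free_ring_closed(3)[of a b] by (simp del: free_ring_simps(1))
      qed
    qed auto
  next
    fix a x :: "'x hset multiset \<Rightarrow>\<^sub>0 int"
    assume a: "a \<in> ?K" and x: "x \<in> carrier free_ring"
    have "\<forall>\<^sub>F n in sequentially. point_count n (a * x) = 0"
      using a by (auto elim: eventually_mono)
    then show "a \<otimes>\<^bsub>free_ring\<^esub> x \<in> ?K" "x \<otimes>\<^bsub>free_ring\<^esub> a \<in> ?K"
      using a x free_ring_closed(5)[of a x] by (simp_all del: free_ring_simps(1) add: mult.commute)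
  qed (rule free_ring.ring_axioms)
  moreover have "relators \<subseteq> ?K"
  proof
    fix r :: "'x hset multiset \<Rightarrow>\<^sub>0 int" assume r: "r \<in> relators"
    have "\<forall>\<^sub>F n in sequentially. point_count n r = 0"
      using r
    proof cases
      case (iso X Y)
      then show ?thesis
        using eventually_fix_count_iso[of X Y] by (auto simp: finitary_def elim: eventually_mono)
    next
      case (singleton X x)
      then show ?thesis by (simp add: fix_count_singleton finitary_def)
    next
      case (sum X Y Z)
      then have "\<forall>\<^sub>F n in sequentially. fix_count Z n = fix_count (hat_sum X Y) n"
        by (intro eventually_fix_count_iso) (auto simp: finitary_def)
      then show ?thesis
        using eventually_fix_count_sum[OF sum(2,3)] unfolding sum(1)
        by eventually_elim simp
    next
      case (conj X g)
      then show ?thesis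
        using eventually_fix_count_conj[of X g] by (auto simp: finitary_def elim: eventually_mono)
    next
      case (fiber X Y f y)
      show ?thesis
        using eventually_fix_count_fiber[OF fiber(2-9)] unfolding fiber(1)
        by eventually_elim simp
    qed
    then show "r \<in> ?K" using r relators_subset by blast
  qed
  ultimately have "relation_ideal \<subseteq> ?K" by (rule free_ring.genideal_minimal)
  then show ?thesis using assms by blast
qed

section \<open>Congruence modulo the relations\<close>

definition theta_eq :: "('x hset multiset \<Rightarrow>\<^sub>0 int) \<Rightarrow> ('x hset multiset \<Rightarrow>\<^sub>0 int) \<Rightarrow> bool"
    (infix "\<simeq>\<^sub>\<Theta>" 50) where
  "p \<simeq>\<^sub>\<Theta> q \<longleftrightarrow> p - q \<in> relation_ideal"

lemma theta_eq_refl [simp]: "p \<simeq>\<^sub>\<Theta> p"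
  by (simp add: theta_eq_def ideal_0)

lemma theta_eq_sym: "p \<simeq>\<^sub>\<Theta> q \<Longrightarrow> q \<simeq>\<^sub>\<Theta> p"
  using ideal_minus[of "p - q"] by (simp add: theta_eq_def)

lemma theta_eq_trans [trans]: "p \<simeq>\<^sub>\<Theta> q \<Longrightarrow> q \<simeq>\<^sub>\<Theta> r \<Longrightarrow> p \<simeq>\<^sub>\<Theta> r"
  using ideal_add[of "p - q" "q - r"] by (simp add: theta_eq_def)

lemma theta_eq_add: "p \<simeq>\<^sub>\<Theta> q \<Longrightarrow> p' \<simeq>\<^sub>\<Theta> q' \<Longrightarrow> p + p' \<simeq>\<^sub>\<Theta> q + q'"
  using ideal_add[of "p - q" "p' - q'"] by (simp add: theta_eq_def algebra_simps)

lemma theta_eq_diff: "p \<simeq>\<^sub>\<Theta> q \<Longrightarrow> p' \<simeq>\<^sub>\<Theta> q' \<Longrightarrow> p - p' \<simeq>\<^sub>\<Theta> q - q'"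
  using ideal_diff[of "p - q" "p' - q'"] by (simp add: theta_eq_def algebra_simps)

lemma theta_eq_sum:
  "(\<And>i. i \<in> I \<Longrightarrow> p i \<simeq>\<^sub>\<Theta> q i) \<Longrightarrow> sum p I \<simeq>\<^sub>\<Theta> sum q I"
  by (induction I rule: infinite_finite_induct) (simp_all add: theta_eq_add)

lemma theta_eq_mult: "p \<simeq>\<^sub>\<Theta> q \<Longrightarrow> r \<in> carrier free_ring \<Longrightarrow> p * r \<simeq>\<^sub>\<Theta> q * r"
  using ideal_mult[of "p - q" r] by (simp add: theta_eq_def left_diff_distrib del: free_ring_simps(1))

lemma theta_eq_iso:
  "finitary X \<Longrightarrow> finitary Y \<Longrightarrow> hat_iso X Y \<Longrightarrow> symbol X \<simeq>\<^sub>\<Theta> symbol Y"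
  unfolding theta_eq_def by (intro relators_in_ideal relators.iso)

text \<open>The subgroup of \<open>\<Theta>\<close> generated by the classes of the \<open>\<Omega>\<^sup>(\<^sup>k\<^sup>)\<close>, pulled back to the free ring.\<close>

definition spanned :: "(nat set hset multiset \<Rightarrow>\<^sub>0 int) \<Rightarrow> bool" where
  "spanned p \<longleftrightarrow> (\<exists>c. p \<simeq>\<^sub>\<Theta> int_comb (\<lambda>k. symbol (Omega_sets k)) c)"

lemma spanned_cong: "p \<simeq>\<^sub>\<Theta> q \<Longrightarrow> spanned q \<Longrightarrow> spanned p"
  unfolding spanned_def using theta_eq_trans by blast

lemma spanned_0: "spanned 0"
  unfolding spanned_def by (intro exI[of _ 0]) simp

lemma spanned_Omega_sets: "spanned (symbol (Omega_sets k))"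
  unfolding spanned_def by (intro exI[of _ "frag_of k"]) simp

lemma spanned_diff: "spanned p \<Longrightarrow> spanned q \<Longrightarrow> spanned (p - q)"
  unfolding spanned_def by (metis theta_eq_diff int_comb_diff)

lemma spanned_add: "spanned p \<Longrightarrow> spanned q \<Longrightarrow> spanned (p + q)"
  using spanned_diff[of p "0 - q"] spanned_diff[OF spanned_0, of q] by simp

lemma spanned_sum: "(\<And>i. i \<in> I \<Longrightarrow> spanned (p i)) \<Longrightarrow> spanned (sum p I)"
  by (induction I rule: infinite_finite_induct) (simp_all add: spanned_0 spanned_add)

section \<open>Decomposing hat-sets\<close>

lemma hat_transitive_iff:
  assumes "hat_set X"
  shows "hat_transitive X \<longleftrightarrow> points X \<noteq> {} \<and>
    (\<forall>x\<in>points X. \<forall>y\<in>points X. \<exists>g\<in>defgrp X. act X g x = y)"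
  using hat_setD(3)[OF assms]
  by (auto simp: hat_transitive_def transitive_action_def transitive_action_axioms_def)

lemma hat_set_shrink:
  assumes X: "hat_set X" and V: "open_subgroup V" "V \<subseteq> defgrp X"
  shows "hat_set (X\<lparr>defgrp := V\<rparr>)"
proof (rule hat_setI)
  have subV: "subgroup V Sym" using V by (simp add: open_subgroup_def)
  have VX: "g \<in> defgrp X" if "g \<in> V" for g using V that by blast
  show "group_action (subgrp (defgrp (X\<lparr>defgrp := V\<rparr>))) (points (X\<lparr>defgrp := V\<rparr>))
      (act (X\<lparr>defgrp := V\<rparr>))"
    using group_action_subgrpI[OF subV, of "act X" "points X"] VX act_closed[OF X] act_one[OF X]
      act_comp[OF X] group_action_subgrpD(1)[OF hat_setD(3)[OF X]] by simp
  show "open_subgroup {g \<in> defgrp (X\<lparr>defgrp := V\<rparr>). act (X\<lparr>defgrp := V\<rparr>) g x = x}"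
    if "x \<in> points (X\<lparr>defgrp := V\<rparr>)" for x
  proof -
    have "{g \<in> V. act X g x = x} = V \<inter> {g \<in> defgrp X. act X g x = x}" using VX by blast
    then show ?thesis
      using open_subgroup_Int[OF V(1) hat_setD(4)[OF X, of x]] that by simp
  qed
qed (use V in simp)

definition hat_restrict :: "'x hset \<Rightarrow> 'x set \<Rightarrow> 'x hset" where
  "hat_restrict X P = \<lparr>defgrp = defgrp X, points = P, act = (\<lambda>g. restrict (act X g) P)\<rparr>"

lemma hat_restrict_simps [simp]:
  "defgrp (hat_restrict X P) = defgrp X"
  "points (hat_restrict X P) = P"
  "x \<in> P \<Longrightarrow> act (hat_restrict X P) g x = act X g x"
  by (simp_all add: hat_restrict_def)

lemma hat_restrict_hat_restrict:
  "Q \<subseteq> P \<Longrightarrow> hat_restrict (hat_restrict X P) Q = hat_restrict X Q"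
  by (simp add: hat_restrict_def Int_absorb2 Int_absorb1)

definition stable :: "'x hset \<Rightarrow> 'x set \<Rightarrow> bool" where
  "stable X P \<longleftrightarrow> P \<subseteq> points X \<and> (\<forall>g\<in>defgrp X. \<forall>x\<in>P. act X g x \<in> P)"

lemma stableD:
  assumes "stable X P"
  shows "P \<subseteq> points X" "x \<in> P \<Longrightarrow> x \<in> points X" "g \<in> defgrp X \<Longrightarrow> x \<in> P \<Longrightarrow> act X g x \<in> P"
  using assms by (auto simp: stable_def)

lemma stable_Diff:
  assumes X: "hat_set X" and P: "stable X P"
  shows "stable X (points X - P)"
proof -
  have "act X g x \<notin> P" if g: "g \<in> defgrp X" and x: "x \<in> points X" "x \<notin> P" for g x
  proof
    assume "act X g x \<in> P"
    then have "act X (Sym_inv g) (act X g x) \<in> P"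
      using stableD(3)[OF P] g subgroup.m_inv_closed[OF defgrp_subgroup[OF X]] by blast
    then show False using act_inv(1)[OF X g x(1)] x(2) by simp
  qed
  then show ?thesis using act_closed[OF X] by (auto simp: stable_def)
qed

lemma hat_set_restrict:
  assumes X: "hat_set X" and P: "stable X P"
  shows "hat_set (hat_restrict X P)"
proof (rule hat_setI)
  show "group_action (subgrp (defgrp (hat_restrict X P))) (points (hat_restrict X P))
      (act (hat_restrict X P))"
    unfolding hat_restrict_simps
    by (rule group_action_subgrpI[OF defgrp_subgroup[OF X]])
       (use stableD[OF P] act_one[OF X] act_comp[OF X] in \<open>auto simp: hat_restrict_def\<close>)
  show "open_subgroup {g \<in> defgrp (hat_restrict X P). act (hat_restrict X P) g x = x}"
    if "x \<in> points (hat_restrict X P)" for x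
    using that stableD(2)[OF P] hat_setD(4)[OF X] by simp
qed (use hat_setD(1)[OF X] in simp)

lemma finitary_restrict:
  assumes X: "finitary X" and P: "stable X P"
  shows "finitary (hat_restrict X P)"
proof -
  let ?G = "subgrp (defgrp X)"
  have hs: "hat_set X" using X by (simp add: finitary_def)
  have "orbit ?G (act (hat_restrict X P)) x = orbit ?G (act X) x" if "x \<in> P" for x
    using that by (simp add: orbit_def)
  then have "orbits ?G P (act (hat_restrict X P)) \<subseteq> orbits ?G (points X) (act X)"
    using stableD(2)[OF P] by (auto simp: orbits_def)
  then have "finite (orbits ?G P (act (hat_restrict X P)))"
    using X finite_subset unfolding finitary_def by blast
  then show ?thesis using hat_set_restrict[OF hs P] by (simp add: finitary_def)
qed

lemma theta_eq_split:
  fixes X :: "'x hset"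
  assumes X: "finitary X" and P: "stable X P"
  shows "symbol X \<simeq>\<^sub>\<Theta> symbol (hat_restrict X P) + symbol (hat_restrict X (points X - P))"
proof -
  have hs: "hat_set X" using X by (simp add: finitary_def)
  let ?Q = "points X - P"
  note Q = stable_Diff[OF hs P]
  let ?f = "\<lambda>x. if x \<in> P then Inl x else Inr x"
  have "bij_betw ?f (points X) (Sum_Type.Plus P ?Q)"
    using stableD(2)[OF P] by (auto simp: bij_betw_def inj_on_def image_iff split: if_splits)
  moreover have "hat_map X (hat_sum (hat_restrict X P) (hat_restrict X ?Q)) ?f"
    unfolding hat_map_def
  proof (intro conjI exI[of _ "defgrp X"] ballI)
    show "?f (act X g x) = act (hat_sum (hat_restrict X P) (hat_restrict X ?Q)) g (?f x)"
      if "g \<in> defgrp X" "x \<in> points X" for g x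
      using that stableD(3)[OF P] stableD(3)[OF Q] by (auto simp: hat_sum_def)
  qed (use hat_setD(1)[OF hs] in \<open>auto simp: hat_sum_def\<close>)
  ultimately have "hat_iso X (hat_sum (hat_restrict X P) (hat_restrict X ?Q))"
    unfolding hat_iso_def by (intro exI[of _ ?f]) (simp add: hat_sum_def)
  then show ?thesis
    unfolding theta_eq_def using X finitary_restrict[OF X P] finitary_restrict[OF X Q]
    by (intro relators_in_ideal relators.sum)
qed

lemma hat_iso_same_points:
  assumes "open_subgroup V" "V \<subseteq> defgrp X" "V \<subseteq> defgrp Y" "points X = points Y"
    and "\<And>g x. g \<in> V \<Longrightarrow> x \<in> points X \<Longrightarrow> act X g x = act Y g x"
  shows "hat_iso X Y"
  unfolding hat_iso_def hat_map_def
  by (intro exI[of _ id] conjI exI[of _ V]) (use assms in auto)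

text \<open>The empty hat-set is the disjoint union of two copies of itself.\<close>

lemma theta_eq_empty:
  assumes X: "finitary X" and "points X = {}"
  shows "symbol X \<simeq>\<^sub>\<Theta> 0"
proof -
  have st: "stable X {}" by (simp add: stable_def)
  have "hat_iso (hat_restrict X {}) X"
    by (rule hat_iso_same_points[of "defgrp X"])
       (use assms hat_setD(1) in \<open>auto simp: finitary_def\<close>)
  then have "symbol (hat_restrict X {}) \<simeq>\<^sub>\<Theta> symbol X"
    by (rule theta_eq_iso[OF finitary_restrict[OF X st] X])
  then have "symbol (hat_restrict X {}) + symbol (hat_restrict X {}) \<simeq>\<^sub>\<Theta> symbol X + symbol X"
    by (intro theta_eq_add)
  then have "symbol X \<simeq>\<^sub>\<Theta> symbol X + symbol X"
    using theta_eq_split[OF X st] assms(2) theta_eq_trans by fastforce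
  then show ?thesis
    using theta_eq_sym[of "symbol X" "symbol X + symbol X"] by (simp add: theta_eq_def)
qed

lemma theta_eq_partition:
  assumes "finite \<O>" "finitary X" "\<Union>\<O> = points X" "\<And>S. S \<in> \<O> \<Longrightarrow> stable X S" "pairwise disjnt \<O>"
  shows "symbol X \<simeq>\<^sub>\<Theta> (\<Sum>S\<in>\<O>. symbol (hat_restrict X S))"
  using assms
proof (induction \<O> arbitrary: X rule: finite_induct)
  case empty
  then show ?case using theta_eq_empty[of X] by simp
next
  case (insert S \<O>)
  let ?P = "points X - S"
  have X: "hat_set X" using insert.prems by (simp add: finitary_def)
  have S: "stable X S" using insert.prems by simp
  have disj: "T \<inter> S = {}" if "T \<in> \<O>" for T
    using insert.prems(4) insert.hyps(2) that by (fastforce simp: pairwise_def disjnt_def)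
  have P: "\<Union>\<O> = ?P" using insert.prems(2) disj by auto
  have "symbol (hat_restrict X ?P) \<simeq>\<^sub>\<Theta> (\<Sum>T\<in>\<O>. symbol (hat_restrict (hat_restrict X ?P) T))"
  proof (rule insert.IH)
    show "stable (hat_restrict X ?P) T" if "T \<in> \<O>" for T
    proof -
      have "stable X T" "T \<subseteq> ?P" using insert.prems(3) that P by auto
      then show ?thesis by (auto simp: stable_def subset_iff)
    qed
    show "pairwise disjnt \<O>" using insert.prems(4) by (rule pairwise_subset) auto
  qed (use P finitary_restrict[OF insert.prems(1) stable_Diff[OF X S]] in simp_all)
  also have "(\<Sum>T\<in>\<O>. symbol (hat_restrict (hat_restrict X ?P) T)) = (\<Sum>T\<in>\<O>. symbol (hat_restrict X T))"
    using P by (intro sum.cong refl) (metis Union_upper hat_restrict_hat_restrict)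
  finally have "symbol (hat_restrict X S) + symbol (hat_restrict X ?P) \<simeq>\<^sub>\<Theta>
      symbol (hat_restrict X S) + (\<Sum>T\<in>\<O>. symbol (hat_restrict X T))"
    by (intro theta_eq_add theta_eq_refl)
  then show ?case
    using theta_eq_split[OF insert.prems(1) S] insert.hyps theta_eq_trans by simp blast
qed

lemma theta_eq_singleton: "finitary X \<Longrightarrow> points X = {x} \<Longrightarrow> symbol X \<simeq>\<^sub>\<Theta> 1"
  unfolding theta_eq_def by (intro relators_in_ideal relators.singleton)

text \<open>The common stabilizer of finitely many points is open. With it as group of definition, \<open>X\<close> is a
disjoint union of singletons.\<close>

lemma theta_eq_finite:
  assumes X: "hat_set X" and fin: "finite (points X)"
  shows "symbol X \<simeq>\<^sub>\<Theta> of_nat (card (points X))"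
proof -
  have finitary: "finitary Z" if "hat_set Z" "points Z = points X" for Z :: "'a hset"
    using that fin by (simp add: finitary_def orbits_def)
  have "open_subgroup (defgrp X \<inter> (\<Inter>x\<in>P. {g \<in> defgrp X. act X g x = x}))"
    if "finite P" "P \<subseteq> points X" for P
    using that
  proof (induction P rule: finite_induct)
    case empty
    then show ?case using hat_setD(1)[OF X] by simp
  next
    case (insert x P)
    have "defgrp X \<inter> (\<Inter>x\<in>insert x P. {g \<in> defgrp X. act X g x = x}) =
        {g \<in> defgrp X. act X g x = x} \<inter> (defgrp X \<inter> (\<Inter>x\<in>P. {g \<in> defgrp X. act X g x = x}))"
      by blast
    then show ?case
      using open_subgroup_Int[OF hat_setD(4)[OF X, of x] insert.IH] insert.prems by simp
  qed
  then have V: "open_subgroup (defgrp X \<inter> (\<Inter>x\<in>points X. {g \<in> defgrp X. act X g x = x}))"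
    (is "open_subgroup ?V") using fin by simp
  let ?Y = "X\<lparr>defgrp := ?V\<rparr>"
  have Y: "hat_set ?Y" by (rule hat_set_shrink[OF X V]) simp
  have iso: "hat_iso X ?Y" by (rule hat_iso_same_points[OF V]) auto
  have fY: "finitary ?Y" and fX: "finitary X" using X Y by (auto intro: finitary)
  have st: "stable ?Y {x}" if "x \<in> points X" for x using that by (auto simp: stable_def)
  have "symbol X \<simeq>\<^sub>\<Theta> symbol ?Y" by (rule theta_eq_iso[OF fX fY iso])
  also have "symbol ?Y \<simeq>\<^sub>\<Theta> (\<Sum>S\<in>(\<lambda>x. {x}) ` points X. symbol (hat_restrict ?Y S))"
    by (rule theta_eq_partition) (use fin fY st in \<open>auto simp: pairwise_def disjnt_def\<close>)
  also have "\<dots> = (\<Sum>x\<in>points X. symbol (hat_restrict ?Y {x}))"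
    by (subst sum.reindex) auto
  also have "\<dots> \<simeq>\<^sub>\<Theta> (\<Sum>x\<in>points X. 1)"
    by (intro theta_eq_sum theta_eq_singleton finitary_restrict[OF fY st]) simp_all
  finally show ?thesis by simp
qed

section \<open>Families of finite subsets\<close>

definition set_action :: "perm set \<Rightarrow> nat set set \<Rightarrow> nat set hset" where
  "set_action U E = \<lparr>defgrp = U, points = E, act = (\<lambda>g. \<lambda>B\<in>E. g ` B)\<rparr>"

lemma set_action_simps [simp]:
  "defgrp (set_action U E) = U" "points (set_action U E) = E"
  "B \<in> E \<Longrightarrow> act (set_action U E) g B = g ` B"
  by (simp_all add: set_action_def)

lemma Omega_sets_eq: "Omega_sets n = set_action (carrier Sym) (nsets Omega n)"
  by (simp add: Omega_sets_def set_action_def)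

lemma hat_set_Omega_sets: "hat_set (Omega_sets n)"
  using finitary_Omega_sets by (auto simp: finitary_def)

lemma hat_set_set_action:
  assumes U: "open_subgroup U" and E: "E \<subseteq> nsets Omega n" "\<And>g B. g \<in> U \<Longrightarrow> B \<in> E \<Longrightarrow> g ` B \<in> E"
  shows "hat_set (set_action U E)"
proof -
  have "U \<subseteq> carrier Sym" using U by (simp add: open_subgroup_def subgroup.subset)
  then have 1: "hat_set ((Omega_sets n)\<lparr>defgrp := U\<rparr>)"
    by (intro hat_set_shrink hat_set_Omega_sets U) (simp add: Omega_sets_eq)
  have "hat_set (hat_restrict ((Omega_sets n)\<lparr>defgrp := U\<rparr>) E)"
    by (rule hat_set_restrict[OF 1]) (use E in \<open>auto simp: stable_def Omega_sets_eq subset_iff\<close>)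
  moreover have "hat_restrict ((Omega_sets n)\<lparr>defgrp := U\<rparr>) E = set_action U E"
    using E by (simp add: hat_restrict_def set_action_def Omega_sets_eq Int_absorb1)
  ultimately show ?thesis by simp
qed

lemma pointwise_stab_image:
  assumes g: "g \<in> pointwise_stab A" and AB: "A \<subseteq> Omega" "B \<subseteq> Omega"
  shows "g ` B \<inter> A = B \<inter> A" "g ` (B - A) = g ` B - A"
proof -
  have gc: "g \<in> carrier Sym" and fixed: "\<And>a. a \<in> A \<Longrightarrow> g a = a"
    using g by (auto simp: pointwise_stab_def)
  have inA: "g b \<in> A \<longleftrightarrow> b \<in> A" if "b \<in> Omega" for b
    using fixed that AB(1) Sym_inv_apply(1)[OF gc] by (metis subset_iff)
  show "g ` B \<inter> A = B \<inter> A"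
    using inA fixed AB(2) by (force simp: image_iff subset_iff)
  show "g ` (B - A) = g ` B - A"
    using inA AB(2) by (auto simp: subset_iff)
qed

text \<open>The nonempty ones among these families are the orbits of the pointwise stabilizer of \<open>A\<close> on \<open>n\<close>-sets.\<close>

definition trace_class :: "nat set \<Rightarrow> nat \<Rightarrow> nat set \<Rightarrow> nat set set" where
  "trace_class A n T = {B \<in> nsets Omega n. B \<inter> A = T}"

lemma trace_class_stable:
  "A \<subseteq> Omega \<Longrightarrow> g \<in> pointwise_stab A \<Longrightarrow> B \<in> trace_class A n T \<Longrightarrow> g ` B \<in> trace_class A n T"
  using pointwise_stab_image(1)[of g A B] Sym_image_nsets[of g B n] pointwise_stab_subset[of A]
  by (auto simp: trace_class_def nsets_def)

lemma trace_class_transitive: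
  assumes "A \<subseteq> Omega" "B \<in> trace_class A n T" "C \<in> trace_class A n T"
  shows "\<exists>g\<in>pointwise_stab A. g ` B = C"
  using assms by (intro pointwise_stab_moves) (auto simp: trace_class_def nsets_def)

lemma trace_class_subset:
  assumes A: "A \<subseteq> Omega" and E: "E \<subseteq> nsets Omega n"
      "\<And>g B. g \<in> pointwise_stab A \<Longrightarrow> B \<in> E \<Longrightarrow> g ` B \<in> E"
    and B: "B \<in> E"
  shows "trace_class A n (B \<inter> A) \<subseteq> E"
proof
  fix C assume C: "C \<in> trace_class A n (B \<inter> A)"
  have "B \<in> trace_class A n (B \<inter> A)" using B E by (auto simp: trace_class_def)
  from trace_class_transitive[OF A this C] show "C \<in> E" using E(2) B by blast
qed

lemma finitary_set_action_pointwise_stab: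
  assumes A: "finite A" "A \<subseteq> Omega" and E: "E \<subseteq> nsets Omega n"
      "\<And>g B. g \<in> pointwise_stab A \<Longrightarrow> B \<in> E \<Longrightarrow> g ` B \<in> E"
  shows "finitary (set_action (pointwise_stab A) E)"
proof -
  let ?X = "set_action (pointwise_stab A) E"
  have "orbit (subgrp (pointwise_stab A)) (act ?X) B = trace_class A n (B \<inter> A)" if B: "B \<in> E" for B
  proof -
    have 1: "B \<in> trace_class A n (B \<inter> A)" using B E by (auto simp: trace_class_def)
    have "orbit (subgrp (pointwise_stab A)) (act ?X) B = {g ` B | g. g \<in> pointwise_stab A}"
      using B by (simp add: orbit_def)
    also have "\<dots> = trace_class A n (B \<inter> A)"
      using trace_class_stable[OF A(2) _ 1] trace_class_transitive[OF A(2) 1] by blast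
    finally show ?thesis .
  qed
  then have "orbits (subgrp (pointwise_stab A)) E (act ?X) \<subseteq> trace_class A n ` Pow A"
    by (auto simp: orbits_def)
  then have "finite (orbits (subgrp (pointwise_stab A)) E (act ?X))"
    using A(1) by (meson finite_Pow_iff finite_imageI finite_subset)
  then show ?thesis
    using hat_set_set_action[OF open_pointwise_stab[OF A] E] by (simp add: finitary_def)
qed

abbreviation avoiding_sets :: "nat set \<Rightarrow> nat \<Rightarrow> nat set hset" where
  "avoiding_sets A j \<equiv> set_action (pointwise_stab A) (nsets (Omega - A) j)"

lemma avoiding_sets_stable:
  assumes "A \<subseteq> Omega" "g \<in> pointwise_stab A" "B \<in> nsets (Omega - A) j"
  shows "g ` B \<in> nsets (Omega - A) j"
proof -
  have "B \<in> trace_class A j {}" using assms by (auto simp: trace_class_def nsets_def)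
  from trace_class_stable[OF assms(1,2) this] show ?thesis by (auto simp: trace_class_def nsets_def)
qed

lemma finitary_avoiding_sets: "finite A \<Longrightarrow> A \<subseteq> Omega \<Longrightarrow> finitary (avoiding_sets A j)"
  by (rule finitary_set_action_pointwise_stab[of _ _ j])
     (auto simp: avoiding_sets_stable, auto simp: nsets_def)

text \<open>Removing \<open>A\<close> from a set with trace \<open>T\<close> loses no information, since \<open>T\<close> is fixed.\<close>

lemma theta_eq_trace_class:
  assumes A: "finite A" "A \<subseteq> Omega" and T: "T \<subseteq> A" "card T \<le> n"
  shows "symbol (set_action (pointwise_stab A) (trace_class A n T)) \<simeq>\<^sub>\<Theta>
    symbol (avoiding_sets A (n - card T))"
proof (rule theta_eq_iso)
  show "finitary (set_action (pointwise_stab A) (trace_class A n T))"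
    by (rule finitary_set_action_pointwise_stab[OF A, of _ n])
       (auto simp: trace_class_stable A, auto simp: trace_class_def)
  show "finitary (avoiding_sets A (n - card T))" by (rule finitary_avoiding_sets[OF A])
  have fT: "finite T" using A T finite_subset by blast
  have bij: "bij_betw (\<lambda>B. B - A) (trace_class A n T) (nsets (Omega - A) (n - card T))"
  proof (rule bij_betwI[of _ _ _ "\<lambda>C. C \<union> T"])
    show "(\<lambda>B. B - A) \<in> trace_class A n T \<rightarrow> nsets (Omega - A) (n - card T)"
    proof
      fix B assume B: "B \<in> trace_class A n T"
      then have "B - A = B - T" "T \<subseteq> B" by (auto simp: trace_class_def)
      then have "card (B - A) = n - card T"
        using B fT by (simp add: card_Diff_subset trace_class_def nsets_def)
      then show "B - A \<in> nsets (Omega - A) (n - card T)"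
        using B by (auto simp: trace_class_def nsets_def)
    qed
    show "(\<lambda>C. C \<union> T) \<in> nsets (Omega - A) (n - card T) \<rightarrow> trace_class A n T"
    proof
      fix C assume C: "C \<in> nsets (Omega - A) (n - card T)"
      then have "C \<inter> T = {}" using T by (auto simp: nsets_def)
      then have "card (C \<union> T) = n"
        using C fT T(2) by (simp add: card_Un_disjoint nsets_def)
      then show "C \<union> T \<in> trace_class A n T"
        using C fT T A by (auto simp: trace_class_def nsets_def)
    qed
  qed (use T in \<open>auto simp: trace_class_def nsets_def\<close>)
  then show "hat_iso (set_action (pointwise_stab A) (trace_class A n T)) (avoiding_sets A (n - card T))"
    unfolding hat_iso_def hat_map_def
  proof (intro exI[of _ "\<lambda>B. B - A"] conjI exI[of _ "pointwise_stab A"] ballI)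
    fix g B
    assume g: "g \<in> pointwise_stab A"
      and "B \<in> points (set_action (pointwise_stab A) (trace_class A n T))"
    then have B: "B \<in> trace_class A n T" by simp
    then have "B - A \<in> nsets (Omega - A) (n - card T)" using bij by (auto simp: bij_betw_def)
    moreover have "g ` (B - A) = g ` B - A"
      using B by (intro pointwise_stab_image(2)[OF g A(2)]) (auto simp: trace_class_def nsets_def)
    ultimately show "act (set_action (pointwise_stab A) (trace_class A n T)) g B - A =
        act (avoiding_sets A (n - card T)) g (B - A)"
      using B by simp
  qed (auto simp: open_pointwise_stab A bij_betw_def)
qed

lemma theta_eq_set_action:
  assumes A: "finite A" "A \<subseteq> Omega" and V: "pointwise_stab A \<subseteq> V"
    and fin: "finitary (set_action V E)"
    and E: "E \<subseteq> nsets Omega n" "\<And>g B. g \<in> V \<Longrightarrow> B \<in> E \<Longrightarrow> g ` B \<in> E"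
  shows "symbol (set_action V E) \<simeq>\<^sub>\<Theta>
    (\<Sum>T\<in>(\<lambda>B. B \<inter> A) ` E. symbol (avoiding_sets A (n - card T)))"
proof -
  let ?X = "set_action (pointwise_stab A) E" and ?\<T> = "(\<lambda>B. B \<inter> A) ` E"
  have E': "g ` B \<in> E" if "g \<in> pointwise_stab A" "B \<in> E" for g B
    using E(2) V that by blast
  have finX: "finitary ?X" by (rule finitary_set_action_pointwise_stab[OF A E(1) E'])
  have fT: "finite ?\<T>" by (rule finite_subset[of _ "Pow A"]) (use A in auto)
  have sub: "trace_class A n T \<subseteq> E" if "T \<in> ?\<T>" for T
    using trace_class_subset[OF A(2) E(1) E'] that by blast
  have inj: "inj_on (trace_class A n) ?\<T>"
  proof (rule inj_onI)
    fix S T assume S: "S \<in> ?\<T>" and eq: "trace_class A n S = trace_class A n T"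
    then obtain B where "B \<in> trace_class A n S" using E(1) by (auto simp: trace_class_def)
    then show "S = T" using eq by (auto simp: trace_class_def)
  qed
  have "symbol (set_action V E) \<simeq>\<^sub>\<Theta> symbol ?X"
    by (rule theta_eq_iso[OF fin finX])
       (rule hat_iso_same_points[OF open_pointwise_stab[OF A]], use V in auto)
  also have "symbol ?X \<simeq>\<^sub>\<Theta> (\<Sum>S\<in>trace_class A n ` ?\<T>. symbol (hat_restrict ?X S))"
  proof (rule theta_eq_partition)
    show "\<Union>(trace_class A n ` ?\<T>) = points ?X"
      using sub E(1) by (auto simp: trace_class_def)
    show "stable ?X S" if "S \<in> trace_class A n ` ?\<T>" for S
    proof -
      obtain T where T: "S = trace_class A n T" "T \<in> ?\<T>" using \<open>S \<in> trace_class A n ` ?\<T>\<close> by auto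
      have ST: "x \<in> E" if "x \<in> S" for x using that T sub by auto
      then show ?thesis
        using trace_class_stable[OF A(2)] T(1) by (simp add: stable_def subset_iff)
    qed
    show "pairwise disjnt (trace_class A n ` ?\<T>)"
      by (auto simp: pairwise_def disjnt_def trace_class_def)
  qed (use fT finX in auto)
  also have "\<dots> = (\<Sum>T\<in>?\<T>. symbol (hat_restrict ?X (trace_class A n T)))"
    by (simp add: sum.reindex[OF inj])
  also have "\<dots> = (\<Sum>T\<in>?\<T>. symbol (set_action (pointwise_stab A) (trace_class A n T)))"
  proof (rule sum.cong[OF refl])
    fix T assume "T \<in> ?\<T>"
    then have "E \<inter> trace_class A n T = trace_class A n T" using sub by blast
    then show "symbol (hat_restrict ?X (trace_class A n T)) =
        symbol (set_action (pointwise_stab A) (trace_class A n T))"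
      by (simp add: hat_restrict_def set_action_def)
  qed
  also have "\<dots> \<simeq>\<^sub>\<Theta> (\<Sum>T\<in>?\<T>. symbol (avoiding_sets A (n - card T)))"
  proof (intro theta_eq_sum theta_eq_trace_class[OF A])
    fix T assume "T \<in> ?\<T>"
    then obtain B where B: "B \<in> nsets Omega n" "T = B \<inter> A" using E by auto
    then show "T \<subseteq> A" "card T \<le> n" by (auto simp: nsets_def intro: card_mono)
  qed
  finally show ?thesis .
qed

lemma theta_eq_Omega_sets:
  assumes A: "finite A" "A \<subseteq> Omega"
  shows "symbol (Omega_sets n) \<simeq>\<^sub>\<Theta>
    (\<Sum>T\<in>(\<lambda>B. B \<inter> A) ` nsets Omega n. symbol (avoiding_sets A (n - card T)))"
  unfolding Omega_sets_eq
  by (rule theta_eq_set_action[OF A])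
     (use finitary_Omega_sets[of n] Sym_image_nsets in \<open>auto simp: Omega_sets_eq pointwise_stab_def\<close>)

text \<open>In the decomposition of \<open>\<Omega>\<^sup>(\<^sup>j\<^sup>)\<close> by traces on \<open>A\<close>, the empty trace contributes the \<open>j\<close>-sets avoiding
\<open>A\<close>, and every other trace contributes smaller sets avoiding \<open>A\<close>.\<close>

lemma spanned_avoiding_sets:
  assumes A: "finite A" "A \<subseteq> Omega"
  shows "spanned (symbol (avoiding_sets A j))"
proof (induction j rule: less_induct)
  case (less j)
  let ?\<T> = "(\<lambda>B. B \<inter> A) ` nsets Omega j"
  let ?Q = "\<lambda>T :: nat set. symbol (avoiding_sets A (j - card T))"
  have fT: "finite ?\<T>" by (rule finite_subset[of _ "Pow A"]) (use A in auto)
  have "infinite (Omega - A)" using A by (simp add: Omega_def infinite_Ici)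
  then obtain B where "finite B" "card B = j" "B \<subseteq> Omega - A"
    using infinite_arbitrarily_large by blast
  then have B: "B \<in> nsets Omega j" "{} = B \<inter> A" unfolding nsets_def by blast+
  have "{} \<in> ?\<T>" by (rule image_eqI[where x = B]) (use B in auto)
  then have eq: "sum ?Q ?\<T> = ?Q {} + sum ?Q (?\<T> - {{}})" using fT by (simp add: sum.remove)
  have "symbol (Omega_sets j) - sum ?Q (?\<T> - {{}}) \<simeq>\<^sub>\<Theta>
      ?Q {} + sum ?Q (?\<T> - {{}}) - sum ?Q (?\<T> - {{}})"
    by (rule theta_eq_diff[OF theta_eq_Omega_sets[OF A, of j, unfolded eq] theta_eq_refl])
  then have "symbol (Omega_sets j) - sum ?Q (?\<T> - {{}}) \<simeq>\<^sub>\<Theta> ?Q {}"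
    by (simp only: add_diff_cancel_right')
  moreover have "spanned (sum ?Q (?\<T> - {{}}))"
  proof (intro spanned_sum less.IH)
    fix T assume T: "T \<in> ?\<T> - {{}}"
    then obtain B where B: "B \<in> nsets Omega j" "T = B \<inter> A" by auto
    then have "finite T" "card T \<le> j" by (auto simp: nsets_def intro: card_mono)
    moreover have "0 < card T" using T \<open>finite T\<close> by (simp add: card_gt_0_iff)
    ultimately show "j - card T < j" by linarith
  qed
  ultimately show ?case
    using spanned_cong[OF theta_eq_sym spanned_diff[OF spanned_Omega_sets]] by simp
qed

lemma spanned_of_nat_mult: "spanned p \<Longrightarrow> spanned (of_nat k * p)"
  by (induction k) (simp_all add: spanned_0 spanned_add distrib_right)

section \<open>Supports and transitive sets\<close>

text \<open>Take a support \<open>B\<close> of least cardinality. Its translates by \<open>W\<close> are supports as well, and so are their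
intersections with \<open>B\<close>; by minimality these intersections are all of \<open>B\<close>.\<close>

lemma minimal_support:
  assumes "open_subgroup W"
  obtains B where "finite B" "B \<subseteq> Omega" "pointwise_stab B \<subseteq> W" "\<And>w. w \<in> W \<Longrightarrow> w ` B = B"
proof -
  have W: "subgroup W Sym" using assms by (simp add: open_subgroup_def)
  let ?P = "\<lambda>B. finite B \<and> B \<subseteq> Omega \<and> pointwise_stab B \<subseteq> W"
  obtain A where "?P A" using assms by (auto simp: open_subgroup_iff)
  then obtain B where B: "?P B" and min: "\<And>C. ?P C \<Longrightarrow> card B \<le> card C"
    using exists_least_iff[of "\<lambda>n. \<exists>B. ?P B \<and> card B = n"] by (metis linorder_not_less)
  have "w ` B = B" if w: "w \<in> W" for w
  proof -
    have wc: "w \<in> carrier Sym" using w subgroup.subset[OF W] by blast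
    have wB: "?P (w ` B)"
      using B Sym_image_subset[OF wc] pointwise_stab_image_le[OF W _ w] by auto
    have "?P (B \<inter> w ` B)"
      using B wB pointwise_stab_Int_le[OF W, of B "w ` B"] by auto
    then have "card B \<le> card (B \<inter> w ` B)" by (rule min)
    then have "B \<inter> w ` B = B" using B by (intro card_seteq) auto
    moreover have "card (w ` B) = card B" using B by (simp add: card_image Sym_inj_on[OF wc])
    ultimately show ?thesis using B card_subset_eq[of "w ` B" B] by auto
  qed
  then show ?thesis using B that by blast
qed

text \<open>With \<open>B\<close> the support of \<open>x\<close> from \<open>minimal_support\<close>, the fibre relation is applied to
\<open>u x \<mapsto> u B\<close>. The fibre over \<open>B\<close> is finite, because it consists of translates of \<open>x\<close> by permutations that
preserve its support.\<close>

lemma spanned_transitive: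
  assumes X: "hat_set X" and tr: "hat_transitive X"
  shows "spanned (symbol X)"
proof -
  let ?U = "defgrp X"
  interpret U: subgroup ?U Sym by (rule defgrp_subgroup[OF X])
  obtain x where x: "x \<in> points X" using tr by (auto simp: hat_transitive_def)
  let ?W = "{g \<in> ?U. act X g x = x}"
  obtain B where B: "finite B" "B \<subseteq> Omega" "pointwise_stab B \<subseteq> ?W" "\<And>w. w \<in> ?W \<Longrightarrow> w ` B = B"
    using minimal_support[OF hat_setD(4)[OF X x]] by blast
  define n where "n = card B"
  define E where "E = (\<lambda>u. u ` B) ` ?U"
  have uc: "u \<in> carrier Sym" if "u \<in> ?U" for u using that by simp
  have E: "E \<subseteq> nsets Omega n"
  proof -
    have "B \<in> nsets Omega n" using B(1,2) by (simp add: nsets_def n_def)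
    then show ?thesis unfolding E_def using Sym_image_nsets uc by blast
  qed
  have comp: "(g \<star> h) ` B = g ` h ` B" if "g \<in> ?U" "h \<in> ?U" for g h
    by (rule Sym_image_comp[OF uc[OF that(1)] uc[OF that(2)] B(2)])
  have stE: "g ` C \<in> E" if gC: "g \<in> ?U" "C \<in> E" for g C
  proof -
    obtain u where u: "u \<in> ?U" "C = u ` B" using gC(2) unfolding E_def by blast
    have "g ` C = (g \<star> u) ` B" using comp[OF gC(1) u(1)] u(2) by simp
    moreover have "g \<star> u \<in> ?U" using gC(1) u(1) by (rule U.m_closed)
    ultimately show ?thesis unfolding E_def by blast
  qed
  let ?Y = "set_action ?U E"
  have Y: "hat_set ?Y" by (rule hat_set_set_action[OF hat_setD(1)[OF X] E stE])
  have trY: "hat_transitive ?Y"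
    unfolding hat_transitive_iff[OF Y]
  proof (intro conjI ballI)
    show "points ?Y \<noteq> {}" by (auto simp: E_def intro: U.one_closed)
    fix C D assume "C \<in> points ?Y" "D \<in> points ?Y"
    then obtain u v where uv: "u \<in> ?U" "v \<in> ?U" "C = u ` B" "D = v ` B" and C: "C \<in> E"
      by (auto simp: E_def)
    have "(v \<star> Sym_inv u) ` C = D"
      using uv comp[of "v \<star> Sym_inv u" u] uc by (simp add: Sym.m_assoc)
    then show "\<exists>g\<in>defgrp ?Y. act ?Y g C = D" using uv C by (auto intro!: bexI[of _ "v \<star> Sym_inv u"])
  qed
  \<comment> \<open>The choice of \<open>u\<close> is immaterial because the stabilizer of \<open>x\<close> preserves \<open>B\<close>.\<close>
  define f where "f z = (SOME u. u \<in> ?U \<and> act X u x = z) ` B" for z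
  have f: "f (act X u x) = u ` B" if u: "u \<in> ?U" for u
  proof -
    define v where "v = (SOME v. v \<in> ?U \<and> act X v x = act X u x)"
    have v: "v \<in> ?U" "act X v x = act X u x"
      using someI[of "\<lambda>v. v \<in> ?U \<and> act X v x = act X u x" u] u by (auto simp: v_def)
    have "Sym_inv u \<star> v \<in> ?W"
      using u v act_comp[OF X _ v(1) x, of "Sym_inv u"] act_inv(1)[OF X u x] by simp
    then have "(Sym_inv u \<star> v) ` B = B" by (rule B(4))
    then have "u ` B = (u \<star> (Sym_inv u \<star> v)) ` B" using u v comp by simp
    also have "\<dots> = v ` B" using u v uc by (simp add: Sym_cancel)
    finally show ?thesis by (simp add: f_def v_def)
  qed
  have orb: "\<exists>u\<in>?U. z = act X u x" if "z \<in> points X" for z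
    using bspec[OF bspec[OF conjunct2[OF tr[unfolded hat_transitive_iff[OF X]]] x] that] by auto
  have B_E: "B \<in> E"
    using imageI[OF U.one_closed, of "\<lambda>u. u ` B"] Sym_image_one[OF B(2)] by (simp add: E_def)
  have fE: "f \<in> points X \<rightarrow> points ?Y"
  proof
    fix z assume "z \<in> points X"
    then obtain u where u: "u \<in> ?U" "z = act X u x" using orb by blast
    then show "f z \<in> points ?Y" using f[OF u(1)] by (simp add: E_def)
  qed
  have eqv: "\<forall>g\<in>defgrp X. \<forall>z\<in>points X. f (act X g z) = act ?Y g (f z)"
  proof (intro ballI)
    fix g z assume g: "g \<in> ?U" and z: "z \<in> points X"
    obtain u where u: "u \<in> ?U" "z = act X u x" using orb[OF z] by blast
    have "f (act X g z) = (g \<star> u) ` B"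
      using f[of "g \<star> u"] g u act_comp[OF X g u(1) x] by simp
    moreover have "u ` B \<in> E" using u by (auto simp: E_def)
    ultimately show "f (act X g z) = act ?Y g (f z)" using f[OF u(1)] u comp[OF g u(1)] by simp
  qed
  have prem: "hat_set X" "hat_set ?Y" "defgrp X = defgrp ?Y" "hat_transitive X" "hat_transitive ?Y"
      "f \<in> points X \<rightarrow> points ?Y" "\<forall>g\<in>defgrp X. \<forall>z\<in>points X. f (act X g z) = act ?Y g (f z)"
      "B \<in> points ?Y"
    using X Y tr trY fE eqv B_E by auto
  let ?F = "hat_fiber X ?Y f B"
  have F: "hat_set ?F" using finitary_hat_fiber[OF prem] by (simp add: finitary_def)
  have "points ?F \<subseteq> (\<lambda>u. act X u x) ` {u \<in> ?U. u ` B \<subseteq> B}"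
  proof
    fix z assume "z \<in> points ?F"
    then have z: "z \<in> points X" "f z = B" by (simp_all add: hat_fiber_def)
    obtain u where u: "u \<in> ?U" "z = act X u x" using orb[OF z(1)] by blast
    then show "z \<in> (\<lambda>u. act X u x) ` {u \<in> ?U. u ` B \<subseteq> B}"
      using f[OF u(1)] z(2) by (intro image_eqI[of _ _ u]) simp_all
  qed
  then have "finite (points ?F)"
    using finite_translates[OF X x B(1-3) B(1)] by (rule finite_subset)
  then have Fk: "symbol ?F \<simeq>\<^sub>\<Theta> of_nat (card (points ?F))" by (rule theta_eq_finite[OF F])
  have finY: "finitary ?Y" by (rule finitary_transitive[OF Y trY])
  have "symbol X \<simeq>\<^sub>\<Theta> symbol ?F * symbol ?Y"
    unfolding theta_eq_def by (rule relators_in_ideal[OF relators.fiber[OF prem]])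
  also have "\<dots> \<simeq>\<^sub>\<Theta> of_nat (card (points ?F)) * symbol ?Y"
    by (rule theta_eq_mult[OF Fk free_ring_closed(2)[OF finY]])
  finally have 1: "symbol X \<simeq>\<^sub>\<Theta> of_nat (card (points ?F)) * symbol ?Y" .
  obtain A where A: "finite A" "A \<subseteq> Omega" "pointwise_stab A \<subseteq> ?U"
    using hat_setD(1)[OF X] by (auto simp: open_subgroup_iff)
  have "spanned (symbol ?Y)"
    by (rule spanned_cong[OF theta_eq_set_action[OF A finY E stE]])
       (auto intro!: spanned_sum spanned_avoiding_sets A)
  then show ?thesis by (rule spanned_cong[OF 1 spanned_of_nat_mult])
qed

lemma spanned_symbol:
  assumes X: "finitary X"
  shows "spanned (symbol X)"
proof -
  let ?\<O> = "orbits (subgrp (defgrp X)) (points X) (act X)"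
  have hs: "hat_set X" and fin: "finite ?\<O>" using X by (auto simp: finitary_def)
  interpret U: subgroup "defgrp X" Sym by (rule defgrp_subgroup[OF hs])
  interpret A: group_action "subgrp (defgrp X)" "points X" "act X" by (rule hat_setD(3)[OF hs])
  have orb: "\<exists>x\<in>points X. S = {act X g x | g. g \<in> defgrp X}" if "S \<in> ?\<O>" for S
    using that by (auto simp: orbits_def orbit_def)
  have st: "stable X S" if S: "S \<in> ?\<O>" for S
  proof -
    obtain x where x: "x \<in> points X" "S = {act X g x | g. g \<in> defgrp X}" using orb[OF S] by blast
    have "act X h (act X g x) \<in> S" if "g \<in> defgrp X" "h \<in> defgrp X" for g h
      using act_comp[OF hs that(2,1) x(1)] that x(2) by (auto intro!: exI[of _ "h \<star> g"])
    then show ?thesis using x act_closed[OF hs] by (auto simp: stable_def)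
  qed
  have "symbol X \<simeq>\<^sub>\<Theta> (\<Sum>S\<in>?\<O>. symbol (hat_restrict X S))"
  proof (rule theta_eq_partition[OF fin X _ st])
    show "\<Union>?\<O> = points X" using points_eq_Union_orbits[OF hs] by simp
    show "pairwise disjnt ?\<O>"
      using A.disjoint_union unfolding pairwise_def disjnt_def by blast
  qed
  moreover have "spanned (\<Sum>S\<in>?\<O>. symbol (hat_restrict X S))"
  proof (intro spanned_sum spanned_transitive)
    fix S assume S: "S \<in> ?\<O>"
    show hS: "hat_set (hat_restrict X S)" by (rule hat_set_restrict[OF hs st[OF S]])
    obtain x where x: "x \<in> points X" "S = {act X g x | g. g \<in> defgrp X}" using orb[OF S] by blast
    have "\<exists>k\<in>defgrp X. act X k (act X g x) = act X h x" if "g \<in> defgrp X" "h \<in> defgrp X" for g h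
    proof
      show "act X (h \<star> Sym_inv g) (act X g x) = act X h x"
        using that act_comp[OF hs that(2), of "Sym_inv g" "act X g x"] act_inv(1)[OF hs that(1) x(1)]
          act_closed[OF hs that(1) x(1)] by simp
    qed (use that in simp)
    moreover have "defgrp X \<noteq> {}" using U.one_closed by blast
    ultimately show "hat_transitive (hat_restrict X S)"
      unfolding hat_transitive_iff[OF hS] using x(2) by auto
  qed
  ultimately show ?thesis by (rule spanned_cong)
qed

section \<open>Products\<close>

text \<open>The fibre relation needs source and target in one universe of points, so a pair of sets of naturals
is encoded as a single such set.\<close>

definition pair_code :: "nat set \<times> nat set \<Rightarrow> nat set" where
  "pair_code = (\<lambda>(A, B). to_nat ` Sum_Type.Plus A B)"

lemma inj_pair_code: "inj pair_code"
proof (rule injI)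
  fix p q assume eq: "pair_code p = pair_code q"
  obtain A B where p: "p = (A, B)" by (cases p)
  obtain C D where q: "q = (C, D)" by (cases q)
  have *: "Sum_Type.Plus A B = Sum_Type.Plus C D"
    using eq unfolding p q pair_code_def case_prod_conv inj_image_eq_iff[OF inj_to_nat] .
  have "A = C" using arg_cong[OF *, of "\<lambda>S. {a. Inl a \<in> S}"]
    by (simp add: Sum_Type.Plus_def image_iff)
  moreover have "B = D" using arg_cong[OF *, of "\<lambda>S. {b. Inr b \<in> S}"]
    by (simp add: Sum_Type.Plus_def image_iff)
  ultimately show "p = q" unfolding p q by simp
qed

abbreviation pair_decode :: "nat set \<Rightarrow> nat set \<times> nat set" where
  "pair_decode \<equiv> inv_into UNIV pair_code"

lemma pair_decode_code [simp]: "pair_decode (pair_code p) = p"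
  by (rule inv_f_f[OF inj_pair_code])

definition disjoint_pairs :: "nat \<Rightarrow> nat \<Rightarrow> (nat set \<times> nat set) set" where
  "disjoint_pairs j n = {(A, B). A \<in> nsets Omega j \<and> B \<in> nsets Omega n \<and> A \<inter> B = {}}"

definition pair_sets :: "nat \<Rightarrow> nat \<Rightarrow> nat set hset" where
  "pair_sets j n = \<lparr>defgrp = carrier Sym, points = pair_code ` disjoint_pairs j n,
     act = (\<lambda>g. \<lambda>z\<in>pair_code ` disjoint_pairs j n.
       pair_code (map_prod ((`) g) ((`) g) (pair_decode z)))\<rparr>"

lemma pair_sets_simps [simp]:
  "defgrp (pair_sets j n) = carrier Sym"
  "points (pair_sets j n) = pair_code ` disjoint_pairs j n"
  "p \<in> disjoint_pairs j n \<Longrightarrow>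
     act (pair_sets j n) g (pair_code p) = pair_code (map_prod ((`) g) ((`) g) p)"
  by (simp_all add: pair_sets_def)

lemma disjoint_pairs_closed:
  assumes g: "g \<in> carrier Sym" and p: "p \<in> disjoint_pairs j n"
  shows "map_prod ((`) g) ((`) g) p \<in> disjoint_pairs j n"
proof -
  obtain A B where AB: "p = (A, B)" "A \<in> nsets Omega j" "B \<in> nsets Omega n" "A \<inter> B = {}"
    using p by (auto simp: disjoint_pairs_def)
  have "g ` A \<inter> g ` B = g ` (A \<inter> B)"
    using AB by (intro inj_on_image_Int[OF Sym_inj_on[OF g order_refl], symmetric]) (auto simp: nsets_def)
  then show ?thesis using AB Sym_image_nsets[OF g] by (simp add: disjoint_pairs_def)
qed

lemma hat_set_pair_sets: "hat_set (pair_sets j n)"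
proof (rule hat_setI)
  show "open_subgroup (defgrp (pair_sets j n))" by (simp add: open_subgroup_carrier)
  show "group_action (subgrp (defgrp (pair_sets j n))) (points (pair_sets j n)) (act (pair_sets j n))"
    unfolding pair_sets_simps(1,2)
  proof (rule group_action_subgrpI[OF Sym.subgroup_self])
    show "act (pair_sets j n) g \<in> extensional (pair_code ` disjoint_pairs j n)" for g
      by (simp add: pair_sets_def)
    show "act (pair_sets j n) g z \<in> pair_code ` disjoint_pairs j n"
      if g: "g \<in> carrier Sym" and "z \<in> pair_code ` disjoint_pairs j n" for g z
      using that disjoint_pairs_closed[OF g] by auto
    show "act (pair_sets j n) \<one>\<^bsub>Sym\<^esub> z = z" if "z \<in> pair_code ` disjoint_pairs j n" for z
      using that by (auto simp: disjoint_pairs_def nsets_def Sym_image_one)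
    show "act (pair_sets j n) (g \<star> h) z = act (pair_sets j n) g (act (pair_sets j n) h z)"
      if g: "g \<in> carrier Sym" and h: "h \<in> carrier Sym" and z: "z \<in> pair_code ` disjoint_pairs j n"
      for g h z
    proof -
      obtain p where p: "z = pair_code p" "p \<in> disjoint_pairs j n" using z by blast
      have "map_prod ((`) (g \<star> h)) ((`) (g \<star> h)) p =
          map_prod ((`) g) ((`) g) (map_prod ((`) h) ((`) h) p)"
        using p(2) by (auto simp: disjoint_pairs_def nsets_def Sym_image_comp[OF g h])
      then show ?thesis using p disjoint_pairs_closed[OF h p(2)] by simp
    qed
  qed
  fix z assume "z \<in> points (pair_sets j n)"
  then obtain A B where z: "z = pair_code (A, B)" and AB: "(A, B) \<in> disjoint_pairs j n" by auto
  have AB': "A \<in> nsets Omega j" "B \<in> nsets Omega n" using AB by (auto simp: disjoint_pairs_def)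
  have "{g \<in> carrier Sym. act (pair_sets j n) g z = z} =
      {g \<in> carrier Sym. g ` A = A} \<inter> {g \<in> carrier Sym. g ` B = B}"
    using AB z by (auto simp: inj_eq[OF inj_pair_code])
  moreover have "open_subgroup {g \<in> carrier Sym. g ` A = A}"
    using hat_setD(4)[OF hat_set_Omega_sets, of A j] AB' by (simp add: Omega_sets_eq)
  moreover have "open_subgroup {g \<in> carrier Sym. g ` B = B}"
    using hat_setD(4)[OF hat_set_Omega_sets, of B n] AB' by (simp add: Omega_sets_eq)
  ultimately show "open_subgroup {g \<in> defgrp (pair_sets j n). act (pair_sets j n) g z = z}"
    by (simp add: open_subgroup_Int)
qed

lemma hat_transitive_Omega_sets: "hat_transitive (Omega_sets n)"
proof -
  have "{1..n} \<in> nsets Omega n" using Icc_Omega by (simp add: nsets_def)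
  then show ?thesis
    using Sym_transitive_on_nsets
    by (auto simp: hat_transitive_iff[OF hat_set_Omega_sets]) (auto simp: Omega_sets_eq)
qed

text \<open>First move \<open>B\<close> to \<open>D\<close>. The image of \<open>A\<close> is then disjoint from \<open>D\<close>, and so is \<open>C\<close>; hence the first
can be moved to the second while \<open>D\<close> stays pointwise fixed.\<close>

lemma hat_transitive_pair_sets: "hat_transitive (pair_sets j n)"
  unfolding hat_transitive_iff[OF hat_set_pair_sets]
proof (intro conjI ballI)
  have "infinite (Omega - {1..n})" by (simp add: Omega_def infinite_Ici)
  then obtain A where "finite A" "card A = j" "A \<subseteq> Omega - {1..n}"
    using infinite_arbitrarily_large by blast
  then have "(A, {1..n}) \<in> disjoint_pairs j n"
    using Icc_Omega by (auto simp: disjoint_pairs_def nsets_def)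
  then show "points (pair_sets j n) \<noteq> {}" by auto
  fix y z assume "y \<in> points (pair_sets j n)" "z \<in> points (pair_sets j n)"
  then obtain A B C D where y: "y = pair_code (A, B)" "(A, B) \<in> disjoint_pairs j n"
    and z: "z = pair_code (C, D)" "(C, D) \<in> disjoint_pairs j n"
    by auto
  have AB: "A \<in> nsets Omega j" "B \<in> nsets Omega n" "A \<inter> B = {}"
    and CD: "C \<in> nsets Omega j" "D \<in> nsets Omega n" "C \<inter> D = {}"
    using y z by (auto simp: disjoint_pairs_def)
  obtain g where g: "g \<in> carrier Sym" "g ` B = D"
    using Sym_transitive_on_nsets[OF AB(2) CD(2)] by blast
  have gA: "g ` A \<in> nsets Omega j" "g ` A \<inter> D = {}"
    using disjoint_pairs_closed[OF g(1) y(2)] g(2) by (auto simp: disjoint_pairs_def)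
  have "\<exists>h\<in>pointwise_stab D. h ` g ` A = C"
    by (rule pointwise_stab_moves) (use gA CD in \<open>auto simp: nsets_def\<close>)
  then obtain h where h: "h \<in> pointwise_stab D" "h ` g ` A = C" by blast
  have hc: "h \<in> carrier Sym" using h pointwise_stab_subset by blast
  have "h ` D = id ` D" using h by (intro image_cong) (auto simp: pointwise_stab_def)
  then have "(h \<star> g) ` A = C" "(h \<star> g) ` B = D"
    using h(2) g AB by (simp_all add: Sym_image_comp[OF hc g(1)] nsets_def)
  then show "\<exists>k\<in>defgrp (pair_sets j n). act (pair_sets j n) k y = z"
    using y z hc g by (intro bexI[of _ "h \<star> g"]) simp_all
qed

text \<open>The sets avoiding \<open>B\<close> are the fibre over \<open>B\<close> of the second projection from disjoint pairs.\<close>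

lemma theta_eq_avoiding_mult:
  assumes B: "B \<in> nsets Omega n"
  shows "symbol (avoiding_sets B j) * symbol (Omega_sets n) \<simeq>\<^sub>\<Theta> symbol (pair_sets j n)"
proof -
  let ?X = "pair_sets j n" and ?Y = "Omega_sets n"
  have B': "finite B" "B \<subseteq> Omega" "card B = n" using B by (auto simp: nsets_def)
  define f where "f z = snd (pair_decode z)" for z
  have f [simp]: "f (pair_code p) = snd p" for p by (simp add: f_def)
  have prem: "hat_set ?X" "hat_set ?Y" "defgrp ?X = defgrp ?Y" "hat_transitive ?X" "hat_transitive ?Y"
      "f \<in> points ?X \<rightarrow> points ?Y" "\<forall>g\<in>defgrp ?X. \<forall>z\<in>points ?X. f (act ?X g z) = act ?Y g (f z)"
      "B \<in> points ?Y"
    using B hat_set_pair_sets[of j n] hat_set_Omega_sets[of n]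
      hat_transitive_pair_sets[of j n] hat_transitive_Omega_sets[of n]
    unfolding Omega_sets_eq by (simp_all, auto simp: disjoint_pairs_def nsets_def)
  let ?F = "hat_fiber ?X ?Y f B"
  have F: "defgrp ?F = {g \<in> carrier Sym. g ` B = B}"
    "points ?F = {z \<in> points ?X. f z = B}" "z \<in> points ?F \<Longrightarrow> act ?F g z = act ?X g z" for g z
    using prem(8) by (auto simp: hat_fiber_def Omega_sets_def stabilizer_def)
  have ptF: "z \<in> points ?F \<longleftrightarrow> (\<exists>A\<in>nsets (Omega - B) j. z = pair_code (A, B))" for z
  proof
    assume "z \<in> points ?F"
    then obtain A where A: "(A, B) \<in> disjoint_pairs j n" "z = pair_code (A, B)"
      unfolding F(2) by auto
    then have "A \<in> nsets (Omega - B) j" unfolding disjoint_pairs_def nsets_def by auto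
    then show "\<exists>A\<in>nsets (Omega - B) j. z = pair_code (A, B)" using A(2) by blast
  next
    assume "\<exists>A\<in>nsets (Omega - B) j. z = pair_code (A, B)"
    then obtain A where A: "A \<in> nsets (Omega - B) j" "z = pair_code (A, B)" by blast
    then have "(A, B) \<in> disjoint_pairs j n"
      using B' unfolding disjoint_pairs_def nsets_def by auto
    then show "z \<in> points ?F" unfolding F(2) using A(2) by simp
  qed
  have "hat_iso ?F (avoiding_sets B j)"
    unfolding hat_iso_def hat_map_def
  proof (intro exI[of _ "\<lambda>z. fst (pair_decode z)"] conjI exI[of _ "pointwise_stab B"] ballI)
    show "pointwise_stab B \<subseteq> defgrp ?F"
    proof
      fix g assume g: "g \<in> pointwise_stab B"
      then have "g ` B = id ` B" by (intro image_cong) (auto simp: pointwise_stab_def)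
      then show "g \<in> defgrp ?F" using g pointwise_stab_subset unfolding F(1) by auto
    qed
    show "bij_betw (\<lambda>z. fst (pair_decode z)) (points ?F) (points (avoiding_sets B j))"
      by (rule bij_betwI[of _ _ _ "\<lambda>A. pair_code (A, B)"]) (auto simp: ptF)
    fix g z assume g: "g \<in> pointwise_stab B" and z: "z \<in> points ?F"
    obtain A where A: "A \<in> nsets (Omega - B) j" "z = pair_code (A, B)" using z ptF by blast
    have "(A, B) \<in> disjoint_pairs j n"
      using A B' by (auto simp: disjoint_pairs_def nsets_def)
    then show "fst (pair_decode (act ?F g z)) = act (avoiding_sets B j) g (fst (pair_decode z))"
      using A z F(3) by simp
  qed (auto simp: ptF open_pointwise_stab B')
  then have "symbol ?F \<simeq>\<^sub>\<Theta> symbol (avoiding_sets B j)"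
    by (intro theta_eq_iso finitary_hat_fiber[OF prem] finitary_avoiding_sets) (use B' in auto)
  then have "symbol (avoiding_sets B j) * symbol ?Y \<simeq>\<^sub>\<Theta> symbol ?F * symbol ?Y"
    by (rule theta_eq_mult[OF theta_eq_sym free_ring_closed(2)[OF finitary_Omega_sets]])
  also have "symbol ?F * symbol ?Y \<simeq>\<^sub>\<Theta> symbol ?X"
    unfolding theta_eq_def[of "symbol ?F * symbol ?Y"]
    using ideal_minus[OF relators_in_ideal[OF relators.fiber[OF prem]]] by simp
  finally show ?thesis .
qed

lemma spanned_Omega_sets_mult: "spanned (symbol (Omega_sets m) * symbol (Omega_sets n))"
proof (rule spanned_cong)
  let ?B = "{1..n}"
  let ?\<T> = "(\<lambda>A. A \<inter> ?B) ` nsets Omega m"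
  have "symbol (Omega_sets m) * symbol (Omega_sets n) \<simeq>\<^sub>\<Theta>
      (\<Sum>T\<in>?\<T>. symbol (avoiding_sets ?B (m - card T))) * symbol (Omega_sets n)"
    by (intro theta_eq_mult theta_eq_Omega_sets[OF _ Icc_Omega] free_ring_closed(2) finitary_Omega_sets)
       simp
  also have "\<dots> = (\<Sum>T\<in>?\<T>. symbol (avoiding_sets ?B (m - card T)) * symbol (Omega_sets n))"
    by (rule sum_distrib_right)
  also have "\<dots> \<simeq>\<^sub>\<Theta> (\<Sum>T\<in>?\<T>. symbol (pair_sets (m - card T) n))"
    by (intro theta_eq_sum theta_eq_avoiding_mult) (use Icc_Omega in \<open>simp add: nsets_def\<close>)
  finally show "symbol (Omega_sets m) * symbol (Omega_sets n) \<simeq>\<^sub>\<Theta>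
      (\<Sum>T\<in>?\<T>. symbol (pair_sets (m - card T) n))" .
  show "spanned (\<Sum>T\<in>?\<T>. symbol (pair_sets (m - card T) n))"
    by (intro spanned_sum spanned_transitive hat_set_pair_sets hat_transitive_pair_sets)
qed

lemma spanned_mult:
  assumes p: "p \<in> carrier free_ring" "spanned p" and q: "q \<in> carrier free_ring" "spanned q"
  shows "spanned (p * q)"
proof -
  let ?\<Omega> = "\<lambda>k. symbol (Omega_sets k) :: nat set hset multiset \<Rightarrow>\<^sub>0 int"
  have \<Omega>: "?\<Omega> k \<in> carrier free_ring" for k by (rule free_ring_closed(2)[OF finitary_Omega_sets])
  obtain c d where c: "p \<simeq>\<^sub>\<Theta> int_comb ?\<Omega> c" and d: "q \<simeq>\<^sub>\<Theta> int_comb ?\<Omega> d"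
    using p q by (auto simp: spanned_def)
  have one: "spanned (int_comb ?\<Omega> d * ?\<Omega> k)" for k
    using subset_UNIV
    by (induction d rule: frag_induction)
       (simp_all add: spanned_0 spanned_Omega_sets_mult int_comb_diff left_diff_distrib spanned_diff)
  have "spanned (int_comb ?\<Omega> c * q)"
    using subset_UNIV
  proof (induction c rule: frag_induction)
    case (one k)
    have "q * ?\<Omega> k \<simeq>\<^sub>\<Theta> int_comb ?\<Omega> d * ?\<Omega> k" by (rule theta_eq_mult[OF d \<Omega>])
    then have "spanned (q * ?\<Omega> k)" using \<open>\<And>k. spanned (int_comb ?\<Omega> d * ?\<Omega> k)\<close> spanned_cong by blast
    then show ?case by (simp add: mult.commute)
  qed (simp_all add: spanned_0 int_comb_diff left_diff_distrib spanned_diff)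
  then show ?thesis using theta_eq_mult[OF c q(1)] spanned_cong by blast
qed

lemma spanned_1: "spanned 1"
proof -
  have "points (Omega_sets 0) = {{}}" by (auto simp: Omega_sets_def nsets_def)
  then have "symbol (Omega_sets 0) \<simeq>\<^sub>\<Theta> 1" by (rule theta_eq_singleton[OF finitary_Omega_sets])
  then show ?thesis using spanned_cong[OF theta_eq_sym spanned_Omega_sets] by blast
qed

lemma spanned_carrier:
  assumes "p \<in> carrier free_ring"
  shows "spanned p"
proof -
  have mono: "frag_of m \<in> carrier free_ring \<and> spanned (frag_of m)"
    if "\<forall>X\<in>#m. finitary X" for m :: "nat set hset multiset"
    using that
  proof (induction m)
    case empty
    have "frag_of {#} = (1 :: nat set hset multiset \<Rightarrow>\<^sub>0 int)" by simp
    then show ?case using spanned_1 free_ring_closed(1) by metis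
  next
    case (add X m)
    have "frag_of (add_mset X m) = symbol X * frag_of m" by (simp add: symbol_def mult_single)
    moreover have "symbol X \<in> carrier free_ring" "spanned (symbol X)"
      using add.prems by (auto intro: free_ring_closed(2) spanned_symbol simp del: free_ring_simps(1))
    moreover have "frag_of m \<in> carrier free_ring" "spanned (frag_of m)" using add by simp_all
    ultimately show ?case using spanned_mult free_ring_closed(5) by metis
  qed
  have "Poly_Mapping.keys p \<subseteq> {m. \<forall>X\<in>#m. finitary X}" using assms by auto
  then show ?thesis
    by (induction p rule: frag_induction) (use mono spanned_0 spanned_diff in auto)
qed

section \<open>Integer-valued polynomials\<close>

lemma poly_binomial_poly_of_nat: "poly (binomial_poly k) (of_nat n) = of_nat (n choose k)"
  by (simp add: poly_binomial_poly binomial_gbinomial)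

lemma gbinomial_of_int_Ints: "(of_int m gchoose k :: 'a::field_char_0) \<in> \<int>"
proof (cases "m \<ge> 0")
  case True
  then have "(of_int m gchoose k :: 'a) = of_nat (nat m choose k)"
    by (simp add: binomial_gbinomial)
  then show ?thesis by simp
next
  case False
  then have "of_nat k - of_int m - 1 = (of_nat (nat (int k - m - 1)) :: 'a)" by simp
  then have "(of_int m gchoose k :: 'a) = (- 1) ^ k * of_nat (nat (int k - m - 1) choose k)"
    by (subst gbinomial_negated_upper) (simp only: binomial_gbinomial)
  then show ?thesis by simp
qed

lemma int_comb_Ints: "(\<And>k. f k \<in> \<int>) \<Longrightarrow> int_comb f c \<in> \<int>"
  unfolding int_comb_def by (intro Ints_sum Ints_mult) auto

lemma poly_int_comb: "poly (int_comb f c) x = int_comb (\<lambda>k. poly (f k) x) c"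
  by (rule additive_int_comb) simp_all

lemma int_valued_polys_simps [simp]:
  "carrier int_valued_polys = {p. \<forall>m::int. poly p (of_int m) \<in> \<int>}"
  "p \<otimes>\<^bsub>int_valued_polys\<^esub> q = p * q" "p \<oplus>\<^bsub>int_valued_polys\<^esub> q = p + q"
  "\<zero>\<^bsub>int_valued_polys\<^esub> = 0" "\<one>\<^bsub>int_valued_polys\<^esub> = 1"
  by (simp_all add: int_valued_polys_def ring_of_type_algebra_def)

lemma int_comb_binomial_int_valued: "int_comb binomial_poly c \<in> carrier int_valued_polys"
  by (simp add: poly_int_comb int_comb_Ints poly_binomial_poly gbinomial_of_int_Ints)

lemma ring_int_valued_polys: "ring int_valued_polys"
proof (rule ringI)
  show "abelian_group int_valued_polys"
  proof (rule abelian_groupI)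
    fix p :: "rat poly" assume "p \<in> carrier int_valued_polys"
    then show "\<exists>q\<in>carrier int_valued_polys. q \<oplus>\<^bsub>int_valued_polys\<^esub> p = \<zero>\<^bsub>int_valued_polys\<^esub>"
      by (intro bexI[of _ "- p"]) simp_all
  qed (simp_all add: algebra_simps)
  show "monoid int_valued_polys"
    by (rule monoidI) (simp_all add: algebra_simps)
qed (simp_all add: algebra_simps)

lemma degree_binomial_poly_le: "degree (binomial_poly k) \<le> k"
proof -
  have "degree (\<Prod>i<k. [:- of_nat i, 1 :: rat:]) \<le> (\<Sum>i<k. 1)"
    by (rule order_trans[OF degree_prod_sum_le]) auto
  then show ?thesis unfolding binomial_poly_def using degree_smult_le order_trans by fastforce
qed

lemma int_comb_cmul_of: "int_comb f (frag_cmul a (frag_of k)) = of_int a * f k"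
proof (cases "a = 0")
  case False
  then have "Poly_Mapping.keys (frag_cmul a (frag_of k)) = {k}"
    by (auto simp: in_keys_iff lookup_single when_def)
  then show ?thesis by (simp add: int_comb_def lookup_single)
qed simp

text \<open>The binomial polynomial of index \<open>d\<close> vanishes at \<open>0, \<dots>, d - 1\<close> and is \<open>1\<close> at \<open>d\<close>, so adding an integer
multiple of it corrects the value at \<open>d\<close> without changing the earlier ones.\<close>

lemma int_valued_interpolation:
  assumes p: "p \<in> carrier int_valued_polys"
  shows "\<exists>c. Poly_Mapping.keys c \<subseteq> {..<d} \<and>
    (\<forall>m<d. poly (int_comb binomial_poly c) (of_nat m) = poly p (of_nat m))"
proof (induction d)
  case 0
  show ?case by (intro exI[of _ 0]) simp
next
  case (Suc d)
  then obtain c where c: "Poly_Mapping.keys c \<subseteq> {..<d}"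
    "\<And>m. m < d \<Longrightarrow> poly (int_comb binomial_poly c) (of_nat m) = poly p (of_nat m)" by blast
  let ?r = "poly p (of_nat d) - poly (int_comb binomial_poly c) (of_nat d)"
  have Ints: "poly q (of_nat d) \<in> \<int>" if "q \<in> carrier int_valued_polys" for q
  proof -
    have "poly q (of_int (int d)) \<in> \<int>" using that unfolding int_valued_polys_simps by blast
    then show ?thesis by simp
  qed
  have "?r \<in> \<int>" by (intro Ints_diff Ints p int_comb_binomial_int_valued)
  then obtain a where a: "?r = of_int a" by (auto elim: Ints_cases)
  let ?c = "c + frag_cmul a (frag_of d)"
  have eq: "poly (int_comb binomial_poly ?c) (of_nat m) =
      poly (int_comb binomial_poly c) (of_nat m) + of_int a * of_nat (m choose d)" for m
    unfolding int_comb_add int_comb_cmul_of by (simp add: poly_binomial_poly_of_nat)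
  have "poly (int_comb binomial_poly ?c) (of_nat m) = poly p (of_nat m)" if "m < Suc d" for m
  proof (cases "m = d")
    case True
    then show ?thesis unfolding eq using a by simp
  next
    case False
    then show ?thesis unfolding eq using that c(2) by simp
  qed
  moreover have "Poly_Mapping.keys ?c \<subseteq> {..<Suc d}"
  proof -
    have "Poly_Mapping.keys ?c \<subseteq> Poly_Mapping.keys c \<union> Poly_Mapping.keys (frag_cmul a (frag_of d))"
      by (rule Poly_Mapping.keys_add)
    also have "\<dots> \<subseteq> {..<d} \<union> {d}"
      using c(1) keys_cmul[of a "frag_of d"] by (intro Un_mono) auto
    also have "\<dots> = {..<Suc d}" by auto
    finally show ?thesis .
  qed
  ultimately show ?case by blast
qed

lemma int_valued_eq_int_comb:
  assumes p: "p \<in> carrier int_valued_polys"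
  shows "\<exists>c. p = int_comb binomial_poly c"
proof -
  let ?d = "Suc (degree p)"
  obtain c where c: "Poly_Mapping.keys c \<subseteq> {..<?d}"
    "\<And>m. m < ?d \<Longrightarrow> poly (int_comb binomial_poly c) (of_nat m) = poly p (of_nat m)"
    using int_valued_interpolation[OF p, of ?d] by blast
  have "degree (int_comb binomial_poly c) \<le> degree p"
    unfolding int_comb_def
  proof (rule degree_sum_le)
    fix k assume "k \<in> Poly_Mapping.keys c"
    then have "k \<le> degree p" using subsetD[OF c(1), of k] by simp
    then have "degree (binomial_poly k) \<le> degree p" by (rule order_trans[OF degree_binomial_poly_le])
    then show "degree (of_int (Poly_Mapping.lookup c k) * binomial_poly k) \<le> degree p"
      using degree_mult_le[of "of_int (Poly_Mapping.lookup c k)" "binomial_poly k"] by simp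
  qed simp
  moreover have "card (of_nat ` {..<?d} :: rat set) = ?d"
    by (subst card_image) (auto intro: inj_on_of_nat)
  ultimately have "int_comb binomial_poly c = p"
    by (intro poly_eqI_degree[of "of_nat ` {..<?d}"]) (use c(2) in auto)
  then show ?thesis by blast
qed

text \<open>At the least index \<open>k\<close> of the combination, all terms but the one of index \<open>k\<close> vanish.\<close>

lemma int_comb_binomial_eq_0:
  assumes "int_comb binomial_poly c = 0"
  shows "c = 0"
proof (rule ccontr)
  assume "c \<noteq> 0"
  then have ne: "Poly_Mapping.keys c \<noteq> {}" by simp
  let ?k = "Min (Poly_Mapping.keys c)"
  have k: "?k \<in> Poly_Mapping.keys c" using ne by (intro Min_in) auto
  have "0 = poly (int_comb binomial_poly c) (of_nat ?k)" using assms by simp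
  also have "\<dots> = (\<Sum>j\<in>Poly_Mapping.keys c. of_int (Poly_Mapping.lookup c j) * of_nat (?k choose j))"
    by (simp add: poly_int_comb poly_binomial_poly_of_nat) (simp add: int_comb_def)
  also have "\<dots> = (\<Sum>j\<in>Poly_Mapping.keys c. if j = ?k then of_int (Poly_Mapping.lookup c j) else 0)"
  proof (rule sum.cong[OF refl])
    fix j assume j: "j \<in> Poly_Mapping.keys c"
    then have "?k \<le> j" by simp
    then show "of_int (Poly_Mapping.lookup c j) * of_nat (?k choose j) =
        (if j = ?k then of_int (Poly_Mapping.lookup c j) else (0 :: rat))"
      by (cases "j = ?k") (auto simp: binomial_eq_0)
  qed
  also have "\<dots> = of_int (Poly_Mapping.lookup c ?k)" using k by simp
  finally show False using k by (simp add: in_keys_iff)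
qed

section \<open>The isomorphism\<close>

lemma poly_eqI_eventually:
  fixes p q :: "rat poly"
  assumes "\<forall>\<^sub>F n in sequentially. poly p (of_nat n) = poly q (of_nat n)"
  shows "p = q"
proof (rule ccontr)
  assume "p \<noteq> q"
  then have "finite {x. poly (p - q) x = 0}" by (intro poly_roots_finite) simp
  then have "finite (of_nat -` {x. poly (p - q) x = 0} :: nat set)"
    by (rule finite_vimageI) (simp add: inj_of_nat)
  moreover obtain N where "\<And>n. n \<ge> N \<Longrightarrow> poly p (of_nat n) = poly q (of_nat n)"
    using assms by (auto simp: eventually_sequentially)
  then have "{N..} \<subseteq> of_nat -` {x. poly (p - q) x = 0}" by auto
  ultimately show False using finite_subset infinite_Ici by blast
qed

text \<open>The polynomial that eventually agrees with the counts; for elements of the free ring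
it exists by \<open>spanned_carrier\<close>.\<close>

definition hilbert_poly :: "(nat set hset multiset \<Rightarrow>\<^sub>0 int) \<Rightarrow> rat poly" where
  "hilbert_poly q = (THE p. \<forall>\<^sub>F n in sequentially. poly p (of_nat n) = of_int (point_count n q))"

lemma hilbert_polyI:
  assumes "\<forall>\<^sub>F n in sequentially. poly p (of_nat n) = of_int (point_count n q)"
  shows "hilbert_poly q = p"
  unfolding hilbert_poly_def
proof (rule the_equality)
  show "\<forall>\<^sub>F n in sequentially. poly p (of_nat n) = of_int (point_count n q)" by (rule assms)
  fix r :: "rat poly"
  assume "\<forall>\<^sub>F n in sequentially. poly r (of_nat n) = of_int (point_count n q)"
  with assms have "\<forall>\<^sub>F n in sequentially. poly r (of_nat n) = poly p (of_nat n)"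
    by eventually_elim simp
  then show "r = p" by (rule poly_eqI_eventually)
qed

lemma hilbert_poly_int_comb:
  assumes "q \<simeq>\<^sub>\<Theta> int_comb (\<lambda>k. symbol (Omega_sets k)) c"
  shows "\<forall>\<^sub>F n in sequentially. poly (int_comb binomial_poly c) (of_nat n) = of_int (point_count n q)"
proof -
  let ?r = "int_comb (\<lambda>k. symbol (Omega_sets k)) c"
  have "poly (int_comb binomial_poly c) (of_nat n) = of_int (point_count n ?r)" for n
  proof -
    have "(of_int (point_count n ?r) :: rat) = int_comb (\<lambda>k. of_int (point_count n (symbol (Omega_sets k)))) c"
      by (rule additive_int_comb) simp_all
    then show ?thesis
      by (simp add: poly_int_comb poly_binomial_poly_of_nat fix_count_Omega_sets)
  qed
  moreover have "\<forall>\<^sub>F n in sequentially. point_count n (q - ?r) = 0"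
    using assms by (intro eventually_point_count_ideal) (simp add: theta_eq_def)
  ultimately show ?thesis by (auto elim: eventually_mono)
qed

lemma eventually_hilbert_poly:
  assumes "q \<in> carrier free_ring"
  shows "\<forall>\<^sub>F n in sequentially. poly (hilbert_poly q) (of_nat n) = of_int (point_count n q)"
  using spanned_carrier[OF assms] hilbert_poly_int_comb hilbert_polyI
  unfolding spanned_def by metis

lemma hilbert_poly_hom: "hilbert_poly \<in> ring_hom free_ring int_valued_polys"
proof (rule ring_hom_memI)
  fix q :: "nat set hset multiset \<Rightarrow>\<^sub>0 int" assume q: "q \<in> carrier free_ring"
  obtain c where "q \<simeq>\<^sub>\<Theta> int_comb (\<lambda>k. symbol (Omega_sets k)) c"
    using spanned_carrier[OF q] by (auto simp: spanned_def)
  then have "hilbert_poly q = int_comb binomial_poly c"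
    by (intro hilbert_polyI hilbert_poly_int_comb)
  then show "hilbert_poly q \<in> carrier int_valued_polys"
    using int_comb_binomial_int_valued by metis
  fix r :: "nat set hset multiset \<Rightarrow>\<^sub>0 int" assume r: "r \<in> carrier free_ring"
  note ev = eventually_hilbert_poly[OF q] eventually_hilbert_poly[OF r]
  have "hilbert_poly (q * r) = hilbert_poly q * hilbert_poly r"
    by (rule hilbert_polyI) (use ev in eventually_elim, simp)
  then show "hilbert_poly (q \<otimes>\<^bsub>free_ring\<^esub> r) = hilbert_poly q \<otimes>\<^bsub>int_valued_polys\<^esub> hilbert_poly r"
    by simp
  have "hilbert_poly (q + r) = hilbert_poly q + hilbert_poly r"
    by (rule hilbert_polyI) (use ev in eventually_elim, simp)
  then show "hilbert_poly (q \<oplus>\<^bsub>free_ring\<^esub> r) = hilbert_poly q \<oplus>\<^bsub>int_valued_polys\<^esub> hilbert_poly r"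
    by simp
next
  show "hilbert_poly \<one>\<^bsub>free_ring\<^esub> = \<one>\<^bsub>int_valued_polys\<^esub>"
    by (simp add: hilbert_polyI)
qed

lemma hilbert_poly_Omega_sets: "hilbert_poly (symbol (Omega_sets k)) = binomial_poly k"
  by (rule hilbert_polyI) (simp add: poly_binomial_poly_of_nat fix_count_Omega_sets)

lemma hilbert_poly_surj: "hilbert_poly ` carrier free_ring = carrier int_valued_polys"
proof
  show "hilbert_poly ` carrier free_ring \<subseteq> carrier int_valued_polys"
    using ring_hom_closed[OF hilbert_poly_hom] by blast
  show "carrier int_valued_polys \<subseteq> hilbert_poly ` carrier free_ring"
  proof
    fix p assume "p \<in> carrier int_valued_polys"
    then obtain c where c: "p = int_comb binomial_poly c" using int_valued_eq_int_comb by blast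
    let ?q = "int_comb (\<lambda>k. symbol (Omega_sets k)) c :: nat set hset multiset \<Rightarrow>\<^sub>0 int"
    have "?q \<in> carrier free_ring"
      using subset_UNIV
    proof (induction c rule: frag_induction)
      case zero
      show ?case by simp
    next
      case (one k)
      show ?case using free_ring_closed(2)[OF finitary_Omega_sets] by (simp del: free_ring_simps)
    next
      case (diff a b)
      then show ?case using free_ring_closed(4) by (simp add: int_comb_diff del: free_ring_simps)
    qed
    moreover have "hilbert_poly ?q = p"
      unfolding c by (intro hilbert_polyI hilbert_poly_int_comb theta_eq_refl)
    ultimately show "p \<in> hilbert_poly ` carrier free_ring" by blast
  qed
qed

text \<open>Modulo the relations, an element of the kernel is a combination of classes of \<open>\<Omega>\<^sup>(\<^sup>k\<^sup>)\<close> whose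
binomial combination is zero, so all coefficients are zero.\<close>

lemma kernel_hilbert_poly: "a_kernel free_ring int_valued_polys hilbert_poly = relation_ideal"
proof (intro equalityI subsetI)
  fix q assume "q \<in> a_kernel free_ring int_valued_polys hilbert_poly"
  then have q: "q \<in> carrier free_ring" "hilbert_poly q = 0"
    unfolding a_kernel_def' by (simp_all del: free_ring_simps(1))
  obtain c where c: "q \<simeq>\<^sub>\<Theta> int_comb (\<lambda>k. symbol (Omega_sets k)) c"
    using spanned_carrier[OF q(1)] by (auto simp: spanned_def)
  then have "int_comb binomial_poly c = 0"
    using q(2) hilbert_polyI[OF hilbert_poly_int_comb] by metis
  then have "c = 0" by (rule int_comb_binomial_eq_0)
  then show "q \<in> relation_ideal" using c by (simp add: theta_eq_def)
next
  fix q :: "nat set hset multiset \<Rightarrow>\<^sub>0 int" assume q: "q \<in> relation_ideal"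
  have "hilbert_poly q = 0"
    using eventually_point_count_ideal[OF q] by (intro hilbert_polyI) (auto elim: eventually_mono)
  then show "q \<in> a_kernel free_ring int_valued_polys hilbert_poly"
    unfolding a_kernel_def' using ideal_carrier[OF q] by (simp del: free_ring_simps(1))
qed

theorem theorem14p4:
  shows "\<exists>i \<in> ring_iso int_valued_polys Theta.
    \<forall>n. i (binomial_poly n) = hclass (Omega_sets n)"
proof -
  interpret h: ring_hom_ring free_ring int_valued_polys hilbert_poly
    by (rule ring_hom_ringI2[OF free_ring.ring_axioms ring_int_valued_polys hilbert_poly_hom])
  let ?e = "\<lambda>S. the_elem (hilbert_poly ` S)"
  have e: "?e \<in> ring_iso Theta int_valued_polys"
    using h.FactRing_iso_set[OF hilbert_poly_surj] unfolding kernel_hilbert_poly Theta_def .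
  have ring: "ring (Theta :: (nat set hset multiset \<Rightarrow>\<^sub>0 int) set ring)"
    unfolding Theta_def by (rule ideal.quotient_is_ring[OF ideal_relation_ideal])
  have "inv_into (carrier Theta) ?e (binomial_poly n) = hclass (Omega_sets n)" for n
  proof (rule inv_into_f_eq)
    show "inj_on ?e (carrier Theta)" using e by (simp add: ring_iso_def bij_betw_def)
    have \<Omega>: "symbol (Omega_sets n) \<in> carrier free_ring"
      by (rule free_ring_closed(2)[OF finitary_Omega_sets])
    then show "hclass (Omega_sets n) \<in> carrier Theta"
      unfolding hclass_def Theta_def by (auto simp: FactRing_def A_RCOSETS_defs a_r_coset_def simp del: free_ring_simps)
    show "?e (hclass (Omega_sets n)) = binomial_poly n"
      using h.the_elem_simp[OF \<Omega>] unfolding kernel_hilbert_poly hclass_def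
      by (simp add: hilbert_poly_Omega_sets)
  qed
  then show ?thesis
    using ring_iso_set_sym[OF ring e] by blast
qed

end
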